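(* Let $p\ge2$ be an integer. For every $m\ge1$, Welter's game $\mathrm{Welter}_m$ is $p$-calm. In particular, if $\tilde\Gamma$ is a $p$-saturation of $\mathrm{Welter}_{m^1}+\cdots+\mathrm{Welter}_{m^k}$ and $\mathbb A=(A^1,\dots,A^k)$ is a position of $\tilde\Gamma$, then \[ \mathrm{sg}_{\tilde\Gamma}(\mathbb A)=\psi_p(A^1)\oplus_p\cdots\oplus_p\psi_p(A^k). \]
   Context: An impartial game is a digraph (positions, moves) with finite maximum walk length from each vertex; $B$ is a descendant of $A$ if there is a path from $A$ to $B$, proper if $B\neq A$. $\mathrm{sg}_\Gamma(A)=\operatorname{mex}\{\mathrm{sg}_\Gamma(B):(A,B)\text{ an edge}\}$. The subtraction game $\Gamma(\mathcal P,\mathcal C)$ ($\mathcal P\subseteq\mathbb N^m$, $\mathcal C\subseteq\mathbb N^m\setminus\{0\}$) has positions $\mathcal P$ and edges $\{(A,B)\in\mathcal P^2:A-B\in\mathcal C\}$. Welter's game is $\mathrm{Welter}_m=\Gamma(\mathcal P,\mathcal W_m)$ where $\mathcal P=\{A\in\mathbb N^m: a^i\ne a^j\text{ for } i<j\}$ and $\mathcal W_m$ is the set of vectors in $\mathbb N^m$ with exactly one nonzero component. The disjunctive sum of subtraction games on $\mathbb N^{m^i}$ is the subtraction game on the product of position sets (in $\mathbb N^{m^1+\cdots+m^k}$) whose moves subtract an allowed vector of one summand in its block of coordinates. $\operatorname{ord}_p$ is the $p$-adic order ($\infty$ at $0$), $\operatorname{mord}_p(C)=\min_i\operatorname{ord}_p(c^i)$,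 $\mathcal S_m^p=\{C\in\mathbb N^m\setminus\{0\}:\operatorname{ord}_p(\sum_ic^i)=\operatorname{mord}_p(C)\}$. A $p$-saturation of $\Gamma(\mathcal P,\mathcal C)$ is a subtraction game $\Gamma(\mathcal P,\tilde{\mathcal C})$ with the same Sprague-Grundy function as $\Gamma(\mathcal P,\mathcal C\cup\mathcal S_m^p)$. $\Gamma(\mathcal P,\mathcal C)$ with $\mathcal C\subseteq\mathcal S_m^p$ is $p$-calm if for every position $A$ and proper descendant $B$, $\mathrm{sg}_{\tilde\Gamma}(A)-\mathrm{sg}_{\tilde\Gamma}(B)\equiv\sum_i(a^i-b^i)\pmod{p^{\operatorname{mord}_p(A-B)+1}}$ for a $p$-saturation $\tilde\Gamma$. $\oplus_p$ is base-$p$ addition without carrying. For a position $A$ of $\mathrm{Welter}_m$, \[ \psi_p(A)=a^1\oplus_p\cdots\oplus_p a^m\oplus_p\Bigl(\bigoplus_{i<j}{}_{p}\;\bigl(p^{\operatorname{ord}_p(a^i-a^j)+1}-1\bigr)\Bigr), \] where the big sum is the $p$-Nim-sum over all pairs $i<j$. It is known (from earlier work) that $\psi_p$ is the Sprague-Grundy function of any $p$-saturation of $\mathrm{Welter}_m$. *)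

theory Defs
  imports "HOL-Number_Theory.Number_Theory" "HOL-Library.Extended_Nat"
begin

section \<open>Impartial games\<close>

definition impartial_game :: "'a set \<Rightarrow> 'a rel \<Rightarrow> bool" where
  "impartial_game V E \<longleftrightarrow>
     E \<subseteq> V \<times> V \<and> (\<forall>A\<in>V. \<exists>N. \<forall>n B. (A, B) \<in> E ^^ n \<longrightarrow> n \<le> N)"

definition mex :: "nat set \<Rightarrow> nat" where
  "mex S = (LEAST n. n \<notin> S)"

text \<open>The recursion equation is \<open>sg_rec\<close> below, valid in every impartial game.\<close>

definition sg :: "'a rel \<Rightarrow> 'a \<Rightarrow> nat" where
  "sg E = wfrec (E\<inverse>) (\<lambda>f A. mex {f B |B. (A, B) \<in> E})"

definition proper_descendant :: "'a rel \<Rightarrow> 'a \<Rightarrow> 'a \<Rightarrow> bool" where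
  "proper_descendant E A B \<longleftrightarrow> (A, B) \<in> E\<^sup>* \<and> B \<noteq> A"

lemma impartial_game_wf:
  assumes "impartial_game V E"
  shows "wf (E\<inverse>)"
  unfolding wf_iff_no_infinite_down_chain
proof
  assume "\<exists>f. \<forall>i. (f (Suc i), f i) \<in> E\<inverse>"
  then obtain f where f: "\<And>i. (f i, f (Suc i)) \<in> E" by blast
  have walk: "(f 0, f n) \<in> E ^^ n" for n
  proof (induction n)
    case (Suc n)
    then show ?case using f[of n] by (rule relpow_Suc_I)
  qed simp
  have "f 0 \<in> V" using f[of 0] assms unfolding impartial_game_def by blast
  then obtain N where "\<And>n B. (f 0, B) \<in> E ^^ n \<Longrightarrow> n \<le> N"
    using assms unfolding impartial_game_def by blast
  from this[OF walk[of "Suc N"]] show False by simp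
qed

lemma sg_rec:
  assumes "impartial_game V E"
  shows "sg E A = mex {sg E B |B. (A, B) \<in> E}"
proof -
  have "sg E A = mex {cut (sg E) (E\<inverse>) A B |B. (A, B) \<in> E}"
    unfolding sg_def by (subst wfrec[OF impartial_game_wf[OF assms]]) (rule refl)
  also have "{cut (sg E) (E\<inverse>) A B |B. (A, B) \<in> E} = {sg E B |B. (A, B) \<in> E}"
    by (auto simp: cut_def)
  finally show ?thesis .
qed

section \<open>Subtraction games\<close>

text \<open>A vector in \<open>\<nat>\<^sup>m\<close> is a list of length \<open>m\<close>.\<close>

definition vecs :: "nat \<Rightarrow> nat list set" where
  "vecs m = {A. length A = m}"

definition zero_vec :: "nat \<Rightarrow> nat list" where
  "zero_vec m = replicate m 0"

definition vdiff :: "nat list \<Rightarrow> nat list \<Rightarrow> nat list" where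
  "vdiff A B = map2 (-) A B"

record subtraction_game =
  dim :: nat
  positions :: "nat list set"
  subtrahends :: "nat list set"

definition is_subtraction_game :: "subtraction_game \<Rightarrow> bool" where
  "is_subtraction_game G \<longleftrightarrow>
     positions G \<subseteq> vecs (dim G) \<and> subtrahends G \<subseteq> vecs (dim G) - {zero_vec (dim G)}"

text \<open>The condition \<open>B \<le> A\<close> says that the integer vector \<open>A - B\<close> lies in \<open>\<nat>\<^sup>m\<close>, so
  that the subtraction of natural numbers in \<open>vdiff\<close> is not truncated.\<close>

definition moves :: "subtraction_game \<Rightarrow> nat list rel" where
  "moves G = {(A, B). A \<in> positions G \<and> B \<in> positions G \<and>
     list_all2 (\<le>) B A \<and> vdiff A B \<in> subtrahends G}"

lemma descendant_le: "(A, B) \<in> (moves G)\<^sup>* \<Longrightarrow> list_all2 (\<le>) B A"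
proof (induction rule: rtrancl_induct)
  case base
  show ?case by (simp add: list_all2_refl)
next
  case (step B C)
  then have "list_all2 (\<le>) C B" by (simp add: moves_def)
  then show ?case using step.IH list_all2_trans[of "(\<le>)" "(\<le>)" "(\<le>)" C B A] by auto
qed

lemma vdiff_eq_zero: "list_all2 (\<le>) B A \<Longrightarrow> vdiff A B = replicate (length A) 0 \<Longrightarrow> A = B"
  by (induction rule: list_all2_induct) (auto simp: vdiff_def)

lemma sum_list_le: "list_all2 (\<le>) B A \<Longrightarrow> sum_list B \<le> sum_list (A :: nat list)"
  by (induction rule: list_all2_induct) auto

lemma sum_list_less: "list_all2 (\<le>) B A \<Longrightarrow> A \<noteq> B \<Longrightarrow> sum_list B < sum_list (A :: nat list)"
proof (induction rule: list_all2_induct)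
  case (Cons b B a A)
  then show ?case using sum_list_le[of B A] by (cases "A = B") auto
qed simp

lemma impartial_game_moves:
  assumes "is_subtraction_game G"
  shows "impartial_game (positions G) (moves G)"
proof -
  have dec: "sum_list B < sum_list A" if "(A, B) \<in> moves G" for A B
  proof (rule sum_list_less)
    show le: "list_all2 (\<le>) B A" using that by (simp add: moves_def)
    have "length A = dim G" "vdiff A B \<noteq> zero_vec (dim G)"
      using that assms by (auto simp: moves_def is_subtraction_game_def vecs_def)
    then show "A \<noteq> B" by (auto simp: vdiff_def zero_vec_def list_eq_iff_nth_eq)
  qed
  have "n + sum_list B \<le> sum_list A" if "(A, B) \<in> moves G ^^ n" for n A B
    using that
  proof (induction n arbitrary: B)
    case (Suc n)
    then obtain C where "(A, C) \<in> moves G ^^ n" "(C, B) \<in> moves G" by auto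
    then show ?case using Suc.IH[of C] dec[of C B] by simp
  qed simp
  then have "\<forall>n B. (A, B) \<in> moves G ^^ n \<longrightarrow> n \<le> sum_list A" for A
    using le_trans[OF le_add1] by blast
  moreover have "moves G \<subseteq> positions G \<times> positions G"
    by (auto simp: moves_def)
  ultimately show ?thesis unfolding impartial_game_def by blast
qed

definition disjunctive_sum :: "subtraction_game list \<Rightarrow> subtraction_game" where
  "disjunctive_sum Gs =
     \<lparr>dim = sum_list (map dim Gs),
      positions = {concat As |As. list_all2 (\<lambda>A G. A \<in> positions G) As Gs},
      subtrahends = {concat ((map (\<lambda>G. zero_vec (dim G)) Gs)[i := C]) |i C.
                       i < length Gs \<and> C \<in> subtrahends (Gs ! i)}\<rparr>"

definition Welter :: "nat \<Rightarrow> subtraction_game" where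
  "Welter m =
     \<lparr>dim = m,
      positions = {A \<in> vecs m. \<forall>i j. i < j \<and> j < m \<longrightarrow> A ! i \<noteq> A ! j},
      subtrahends = {C \<in> vecs m. \<exists>!i. i < m \<and> C ! i \<noteq> 0}\<rparr>"

section \<open>\<open>p\<close>-saturations and \<open>p\<close>-calm games\<close>

definition ord_p :: "nat \<Rightarrow> int \<Rightarrow> enat" where
  "ord_p p x = (if x = 0 then \<infinity> else enat (multiplicity (int p) x))"

definition mord_p :: "nat \<Rightarrow> nat list \<Rightarrow> enat" where
  "mord_p p C = Min ((\<lambda>c. ord_p p (int c)) ` set C)"

definition sat_vecs :: "nat \<Rightarrow> nat \<Rightarrow> nat list set" where
  "sat_vecs p m =
     {C \<in> vecs m - {zero_vec m}. ord_p p (int (sum_list C)) = mord_p p C}"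

definition p_saturation :: "nat \<Rightarrow> subtraction_game \<Rightarrow> subtraction_game \<Rightarrow> bool" where
  "p_saturation p G G' \<longleftrightarrow>
     is_subtraction_game G' \<and> dim G' = dim G \<and> positions G' = positions G \<and>
     (\<forall>A\<in>positions G. sg (moves G') A =
        sg (moves (G\<lparr>subtrahends := subtrahends G \<union> sat_vecs p (dim G)\<rparr>)) A)"

text \<open>All \<open>p\<close>-saturations of \<open>G\<close> have the same Sprague-Grundy function, and \<open>G\<close> has at
  least one, so it does not matter which one is used in the congruence.  By
  \<open>descendant_le\<close>, \<open>vdiff A B\<close> is the true difference \<open>A - B\<close>; it is nonzero, so its
  \<open>mord_p\<close> is finite.\<close>

definition p_calm :: "nat \<Rightarrow> subtraction_game \<Rightarrow> bool" where
  "p_calm p G \<longleftrightarrow>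
     is_subtraction_game G \<and> subtrahends G \<subseteq> sat_vecs p (dim G) \<and>
     (\<forall>G' A B. p_saturation p G G' \<and> A \<in> positions G \<and> proper_descendant (moves G) A B \<longrightarrow>
        [int (sg (moves G') A) - int (sg (moves G') B) =
         (\<Sum>i<dim G. int (A ! i) - int (B ! i))]
        (mod (int p ^ (the_enat (mord_p p (vdiff A B)) + 1))))"

section \<open>Addition without carrying and the function \<open>\<psi>\<^sub>p\<close>\<close>

definition digit :: "nat \<Rightarrow> nat \<Rightarrow> nat \<Rightarrow> nat" where
  "digit p n L = n div p ^ L mod p"

text \<open>For \<open>p \<ge> 2\<close> all digits of \<open>a\<close> and \<open>b\<close> in positions above \<open>a + b\<close> vanish.\<close>

definition nim_add :: "nat \<Rightarrow> nat \<Rightarrow> nat \<Rightarrow> nat" where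
  "nim_add p a b = (\<Sum>L\<le>a + b. ((digit p a L + digit p b L) mod p) * p ^ L)"

definition nim_sum :: "nat \<Rightarrow> nat list \<Rightarrow> nat" where
  "nim_sum p xs = foldr (nim_add p) xs 0"

definition psi :: "nat \<Rightarrow> nat list \<Rightarrow> nat" where
  "psi p A = nim_add p (nim_sum p A)
     (nim_sum p [p ^ (the_enat (ord_p p (int (A ! i) - int (A ! j))) + 1) - 1.
        i \<leftarrow> [0..<length A], j \<leftarrow> [i + 1..<length A]])"

end

theory Submission
  imports Defs
begin

text \<open>If two positions agree modulo \<open>p ^ M\<close>, then a pair of coordinates has either the same order below \<open>M\<close>
  in both or order at least \<open>M\<close> in both, so \<open>\<psi>\<^sub>p\<close> changes by the sum of the coordinate differences modulo \<open>p ^ (M + 1)\<close>. Hence the sum of the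
  values changes along every move, and \<open>A - B\<close> is a move as soon as \<open>A\<close> and \<open>B\<close> agree modulo the
  largest power of \<open>p\<close> dividing the difference of their values. It remains to reach every smaller value by
  such a \<open>B\<close>. Splitting the coordinates by their residues modulo \<open>p ^ M\<close> turns one Welter position into
  a sum of \<open>p ^ M\<close> Welter positions without any congruence condition, and the case of \<open>p\<close>-saturated Nim
  reduces these to single positions. There it suffices to find, for a value \<open>n > 0\<close>, one
  lower position with value at least \<open>n - 1\<close>; this is done by moving one bead between two residue
  classes, all digits above those of the residues being preserved by a pigeonhole argument.\<close>

section \<open>Digits and addition without carrying\<close>

lemma digit_less: "p \<ge> 2 \<Longrightarrow> digit p n L < p"
  by (simp add: digit_def)

lemma digit_0: "digit p n 0 = n mod p"
  by (simp add: digit_def)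

lemma digit_mult_add:
  assumes "p \<ge> 2" "r < p ^ J"
  shows "digit p (p ^ J * q + r) (J + L) = digit p q L"
  using assms by (simp add: digit_def power_add div_mult2_eq)

lemma digit_div: "digit p (n div p ^ J) L = digit p n (J + L)"
  by (simp add: digit_def power_add div_mult2_eq)

lemma mod_power_Suc_digit: "n mod p ^ Suc L = n mod p ^ L + p ^ L * digit p n L"
  using mod_mult2_eq[of n "p ^ L" p] by (simp only: digit_def power_Suc2)

lemma digit_mono:
  assumes p: "p \<ge> 2"
  shows "(\<And>L. digit p a L \<le> digit p b L) \<Longrightarrow> a \<le> b"
proof (induction a arbitrary: b rule: less_induct)
  case (less a)
  show ?case
  proof (cases "a = 0")
    case False
    then have "a div p < a" using p by simp
    moreover have "digit p (a div p) L \<le> digit p (b div p) L" for L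
      using less.prems[of "Suc L"] digit_div[of p _ 1 L] by simp
    ultimately have "a div p \<le> b div p" by (rule less.IH)
    moreover have "a mod p \<le> b mod p" using less.prems[of 0] by (simp add: digit_0)
    ultimately have "p * (a div p) + a mod p \<le> p * (b div p) + b mod p"
      by (intro add_mono mult_left_mono) auto
    then show ?thesis by simp
  qed simp
qed

lemma digit_eqI:
  assumes "p \<ge> 2" and eq: "\<And>L. digit p a L = digit p b L"
  shows "a = b"
  using digit_mono[OF assms(1) eq_refl[OF eq]] digit_mono[OF assms(1) eq_refl[OF eq[symmetric]]]
  by (rule antisym)

lemma mod_power_eq_iff_digits:
  "a mod p ^ M = b mod p ^ M \<longleftrightarrow> (\<forall>L<M. digit p a L = digit p b L)"
  if "p \<ge> 2"
proof (induction M)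
  case (Suc M)
  have "a mod p ^ Suc M = b mod p ^ Suc M \<Longrightarrow> a mod p ^ M = b mod p ^ M"
    by (metis le_imp_power_dvd mod_mod_cancel lessI less_imp_le_nat)
  moreover have "p ^ M > 0" using that by simp
  ultimately show ?case
    using Suc by (auto simp: mod_power_Suc_digit less_Suc_eq simp del: power_Suc)
qed simp

lemma int_digit: "int (digit p n L) = (int n div int p ^ L) mod int p"
  by (simp add: digit_def zdiv_int zmod_int)

lemma digit_nim_add:
  assumes p: "p \<ge> 2"
  shows "digit p (nim_add p a b) L = (digit p a L + digit p b L) mod p"
proof -
  define c where "c L = (digit p a L + digit p b L) mod p" for L
  have small: "n < p ^ Suc n" for n
    using less_exp[of "Suc n"] power_mono[of 2 p "Suc n"] p by linarith
  have z: "digit p a L = 0 \<and> digit p b L = 0" if "L > a + b" for L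
  proof -
    have "a < p ^ L" "b < p ^ L"
      using small[of a] small[of b] that p power_increasing[of "Suc a" L p] power_increasing[of "Suc b" L p]
      by linarith+
    then show ?thesis by (simp add: digit_def)
  qed
  have cl: "c L < p" for L using p by (simp add: c_def)
  have bound: "(\<Sum>L<n. c L * p ^ L) < p ^ n" for n
  proof (induction n)
    case (Suc n)
    have "c n * p ^ n + p ^ n \<le> p * p ^ n" using cl[of n] mult_right_mono[of "Suc (c n)" p "p ^ n"] by simp
    then show ?case using Suc by simp
  qed simp
  have dig: "digit p (\<Sum>L<n. c L * p ^ L) L = (if L < n then c L else 0)" for n L
  proof (induction n)
    case (Suc n)
    define s where "s = (\<Sum>L<n. c L * p ^ L)"
    have s: "s < p ^ n" using bound by (simp add: s_def)
    have eq: "(\<Sum>L<Suc n. c L * p ^ L) = p ^ n * c n + s" by (simp add: s_def mult.commute)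
    show ?case
    proof (cases "L < n")
      case True
      have "digit p (p ^ n * c n + s) L = digit p s L"
        using mod_power_eq_iff_digits[OF p, of "p ^ n * c n + s" n s] True by simp
      then show ?thesis using Suc True unfolding eq by (simp add: s_def)
    next
      case False
      then obtain l where l: "L = n + l" by (metis le_add_diff_inverse not_less)
      show ?thesis unfolding eq unfolding l digit_mult_add[OF p s]
        using cl[of n] False l p order_less_le_trans[OF cl[of n], of "p ^ l"]
        by (cases l) (simp_all add: digit_def)
    qed
  qed (simp add: digit_def)
  have "nim_add p a b = (\<Sum>L<Suc (a + b). c L * p ^ L)"
    by (simp add: nim_add_def c_def lessThan_Suc_atMost)
  then show ?thesis
    using dig[of "Suc (a + b)" L] z[of L] p by (auto simp: c_def)
qed

lemma digit_nim_sum: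
  "p \<ge> 2 \<Longrightarrow> digit p (nim_sum p xs) L = (\<Sum>x\<leftarrow>xs. digit p x L) mod p"
proof (induction xs)
  case (Cons x xs)
  then have "digit p (nim_sum p (x # xs)) L = (digit p x L + (\<Sum>x\<leftarrow>xs. digit p x L) mod p) mod p"
    by (simp add: nim_sum_def digit_nim_add)
  then show ?case by (simp add: mod_add_right_eq)
qed (simp add: nim_sum_def digit_def)

lemma digit_power_minus_one:
  assumes "p \<ge> 2"
  shows "digit p (p ^ n - 1) L = (if L < n then p - 1 else 0)"
proof (cases "L < n")
  case True
  then obtain l where l: "n = L + Suc l" by (metis add_Suc_right less_imp_Suc_add)
  have "p ^ n - 1 = p ^ L * (p ^ Suc l - 1) + (p ^ L - 1)"
    using assms by (simp add: l power_add algebra_simps)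
  then have "digit p (p ^ n - 1) (L + 0) = digit p (p ^ Suc l - 1) 0"
    using digit_mult_add[of p "p ^ L - 1" L "p ^ Suc l - 1" 0] assms by simp
  moreover have "p ^ Suc l - 1 = p * (p ^ l - 1) + (p - 1)" using assms by (simp add: algebra_simps)
  moreover have "(p * (p ^ l - 1) + (p - 1)) mod p = p - 1"
    using assms by (simp only: mod_mult_self4) simp
  ultimately show ?thesis using True assms by (simp only: digit_0 if_True add_0_right)
next
  case False
  then have "p ^ n \<le> p ^ L" using assms by (intro power_increasing) auto
  moreover have "p ^ n > 0" using assms by simp
  ultimately have "p ^ n - 1 < p ^ L" by linarith
  then show ?thesis using False by (simp add: digit_def)
qed

text \<open>Subtracting one borrows through the trailing zeros: they become p - 1 and the lowest
  nonzero digit drops by one. This serves to recognise moves that lower a value by exactly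
  one.\<close>

lemma eq_pred_from_digits:
  assumes p: "p \<ge> 2"
    and low: "\<And>L. L < N \<Longrightarrow> digit p n L = 0" "\<And>L. L < N \<Longrightarrow> digit p n' L = p - 1"
    and mid: "Suc (digit p n' N) = digit p n N"
    and high: "\<And>L. L > N \<Longrightarrow> digit p n' L = digit p n L"
  shows "Suc n' = n"
proof -
  have "n mod p ^ N = 0 mod p ^ N"
    using low(1) by (subst mod_power_eq_iff_digits[OF p]) (auto simp: digit_def)
  moreover have "n' mod p ^ N = (p ^ N - 1) mod p ^ N"
    using low(2) by (subst mod_power_eq_iff_digits[OF p]) (auto simp: digit_power_minus_one[OF p] simp del: One_nat_def)
  moreover have "n' div p ^ Suc N = n div p ^ Suc N"
    by (rule digit_eqI[OF p]) (simp add: digit_div high del: power_Suc)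
  moreover have "p ^ N > 0" using p by simp
  ultimately have "n mod p ^ Suc N = Suc (n' mod p ^ Suc N)"
    using mid by (simp add: mod_power_Suc_digit flip: mid del: power_Suc)
  then have "Suc (p ^ Suc N * (n' div p ^ Suc N) + n' mod p ^ Suc N)
      = p ^ Suc N * (n div p ^ Suc N) + n mod p ^ Suc N"
    using \<open>n' div p ^ Suc N = n div p ^ Suc N\<close> by simp
  then show ?thesis by (simp del: power_Suc)
qed

section \<open>Options in p-saturated Nim\<close>

lemma bounded_sum_split:
  fixes v :: "nat \<Rightarrow> nat"
  shows "t \<le> sum v {..<k} \<Longrightarrow> \<exists>w. (\<forall>j<k. w j \<le> v j) \<and> sum w {..<k} = t"
proof (induction k arbitrary: t)
  case (Suc k)
  define d where "d = min t (v k)"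
  have "t - d \<le> sum v {..<k}" using Suc.prems by (simp add: d_def)
  from Suc.IH[OF this] obtain w where "\<forall>j<k. w j \<le> v j" "sum w {..<k} = t - d" by blast
  then show ?case
    by (intro exI[of _ "w(k := d)"]) (auto simp: d_def less_Suc_eq)
qed simp

text \<open>All piles may be lowered at once, and the last digit is split off in each step. If h is
  smaller already above the last digit, some pile has dropped there and its last digit is free to
  correct the sum; otherwise the quotients stay and only last digits are lowered.\<close>

lemma nim_reachable:
  fixes n :: "nat \<Rightarrow> nat"
  assumes p: "p \<ge> 2"
  shows "(\<And>L. digit p s L = (\<Sum>j<k. digit p (n j) L) mod p) \<Longrightarrow> h \<le> s \<Longrightarrow>
    \<exists>f. (\<forall>j<k. f j \<le> n j) \<and> (\<forall>L. digit p h L = (\<Sum>j<k. digit p (f j) L) mod p)"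
proof (induction s arbitrary: h n rule: less_induct)
  case (less s)
  have s0: "s mod p = (\<Sum>j<k. n j mod p) mod p" using less.prems(1)[of 0] by (simp add: digit_0)
  have s1: "digit p (s div p) L = (\<Sum>j<k. digit p (n j div p) L) mod p" for L
    using less.prems(1)[of "Suc L"] digit_div[of p _ 1 L] by simp
  have build: "\<exists>f. (\<forall>j<k. f j \<le> n j) \<and> (\<forall>L. digit p h L = (\<Sum>j<k. digit p (f j) L) mod p)"
    if g: "\<And>L. digit p (h div p) L = (\<Sum>j<k. digit p (g j) L) mod p"
      and v: "h mod p = (\<Sum>j<k. v j) mod p" "\<And>j. j < k \<Longrightarrow> v j < p"
      and le: "\<And>j. j < k \<Longrightarrow> p * g j + v j \<le> n j" for g v
  proof (intro exI[of _ "\<lambda>j. p * g j + v j"] conjI allI impI)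
    fix L
    show "digit p h L = (\<Sum>j<k. digit p (p * g j + v j) L) mod p"
    proof (cases L)
      case 0
      then show ?thesis using v by (simp add: digit_0)
    next
      case (Suc l)
      have "(\<Sum>j<k. digit p (p * g j + v j) L) = (\<Sum>j<k. digit p (g j) l)"
        using digit_mult_add[OF p, of _ 1 _ l] v(2) by (intro sum.cong) (auto simp: Suc)
      then show ?thesis using g[of l] digit_div[of p h 1 l] by (simp add: Suc)
    qed
  qed (use le in auto)
  consider "h div p < s div p" | "h div p = s div p"
    using div_le_mono[OF less.prems(2), of p] by linarith
  then show ?case
  proof cases
    case 1
    then have "s \<noteq> 0" by (metis div_0 not_less0)
    then have "s div p < s" using p by simp
    then obtain g where g: "\<forall>j<k. g j \<le> n j div p"
      "\<And>L. digit p (h div p) L = (\<Sum>j<k. digit p (g j) L) mod p"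
      using less.IH[OF \<open>s div p < s\<close>, of "\<lambda>j. n j div p" "h div p"] s1 1 by auto
    have "\<exists>i<k. g i < n i div p"
    proof (rule ccontr)
      assume "\<not> ?thesis"
      then have eq: "g j = n j div p" if "j < k" for j
        using g(1) that by (metis le_neq_implies_less)
      have "digit p (h div p) L = digit p (s div p) L" for L
        using g(2)[of L] s1[of L] eq by simp
      from digit_eqI[OF p this] show False using 1 by simp
    qed
    then obtain i where i: "i < k" "g i < n i div p" by blast
    \<comment> \<open>Pile i drops in its quotient, so its last digit may be chosen freely; (p - 1)
      * T plays the role of -T modulo p.\<close>
    define T where "T = (\<Sum>j\<in>{..<k} - {i}. n j mod p)"
    define v where "v = (\<lambda>j. n j mod p)(i := (h + (p - 1) * T) mod p)"
    have "(\<Sum>j<k. v j) = v i + (\<Sum>j\<in>{..<k} - {i}. v j)"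
      using i(1) by (intro sum.remove) auto
    also have "(\<Sum>j\<in>{..<k} - {i}. v j) = T"
      unfolding T_def by (intro sum.cong) (auto simp: v_def)
    finally have "(\<Sum>j<k. v j) mod p = (h + (p - 1) * T + T) mod p"
      by (simp add: v_def mod_simps)
    also have "h + (p - 1) * T + T = h + p * T"
      using p by (cases p) (simp_all add: algebra_simps)
    finally have sv: "h mod p = (\<Sum>j<k. v j) mod p" by simp
    have vl: "v j < p" for j using p by (simp add: v_def)
    show ?thesis
    proof (rule build[OF g(2) sv vl])
      fix j assume j: "j < k"
      show "p * g j + v j \<le> n j"
      proof (cases "j = i")
        case True
        have "p * g i + p \<le> p * (n i div p)"
          using mult_le_mono2[of "Suc (g i)" "n i div p" p] i(2) by simp
        then show ?thesis unfolding True
          using vl[of i] times_div_less_eq_dividend[of p "n i"] by linarith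
      next
        case False
        have "p * g j + n j mod p \<le> p * (n j div p) + n j mod p"
          using g(1) j by (intro add_right_mono mult_le_mono2) simp
        then show ?thesis using False by (simp add: v_def)
      qed
    qed
  next
    case 2
    \<comment> \<open>The last digits add up to \<open>T\<close>, which is congruent to s mod p and
      at least as large, so they can absorb a decrease by s mod p - h mod p.\<close>
    have "h mod p \<le> s mod p"
      using less.prems(2) 2 by (metis add_le_cancel_left mult_div_mod_eq)
    moreover define T where "T = (\<Sum>j<k. n j mod p)"
    moreover have "s mod p \<le> T" using s0 by (simp add: T_def)
    ultimately have "T - (s mod p - h mod p) \<le> T" by simp
    then obtain v where v: "\<forall>j<k. v j \<le> n j mod p" "(\<Sum>j<k. v j) = T - (s mod p - h mod p)"
      using bounded_sum_split[where v = "\<lambda>j. n j mod p" and k = k] unfolding T_def by blast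
    have "[(\<Sum>j<k. v j) + s mod p = T + h mod p] (mod p)"
      using \<open>h mod p \<le> s mod p\<close> \<open>s mod p \<le> T\<close> v(2) by (simp add: cong_def)
    moreover have "[T = s mod p] (mod p)" using s0 by (simp add: T_def cong_def)
    ultimately have "[(\<Sum>j<k. v j) + s mod p = h mod p + s mod p] (mod p)"
      by (metis add.commute cong_add_rcancel_nat cong_trans)
    then have sv: "h mod p = (\<Sum>j<k. v j) mod p"
      by (simp add: cong_add_rcancel_nat) (simp add: cong_def)
    show ?thesis
    proof (rule build[OF _ sv])
      show "digit p (h div p) L = (\<Sum>j<k. digit p (n j div p) L) mod p" for L
        using s1 2 by simp
      show "v j < p" if "j < k" for j
        using v(1) that p le_less_trans[of "v j" "n j mod p" p] by simp
      show "p * (n j div p) + v j \<le> n j" if "j < k" for j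
        using v(1) that add_left_mono[of "v j" "n j mod p" "p * (n j div p)"] by simp
    qed
  qed
qed

text \<open>Every pile keeps its M low digits and the play takes place on the quotients by p^M; the
  congruence of h and s makes the low digits of the sum come out right.\<close>

lemma nim_reachable_cong:
  fixes n :: "nat \<Rightarrow> nat"
  assumes p: "p \<ge> 2" and s: "\<And>L. digit p s L = (\<Sum>j<k. digit p (n j) L) mod p"
    and "h \<le> s" "[h = s] (mod p ^ M)"
  shows "\<exists>f. (\<forall>j<k. f j \<le> n j \<and> [f j = n j] (mod p ^ M)) \<and>
    (\<forall>L. digit p h L = (\<Sum>j<k. digit p (f j) L) mod p)"
proof -
  obtain g where g: "\<forall>j<k. g j \<le> n j div p ^ M"
    "\<forall>L. digit p (h div p ^ M) L = (\<Sum>j<k. digit p (g j) L) mod p"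
    using nim_reachable[OF p, where s = "s div p ^ M" and n = "\<lambda>j. n j div p ^ M" and h = "h div p ^ M" and k = k] s
      div_le_mono[OF assms(3)] by (auto simp: digit_div)
  define f where "f j = p ^ M * g j + n j mod p ^ M" for j
  have c: "f j mod p ^ M = n j mod p ^ M" for j by (simp add: f_def)
  have "f j \<le> n j" if "j < k" for j
  proof -
    have "f j \<le> p ^ M * (n j div p ^ M) + n j mod p ^ M"
      unfolding f_def using g(1) that by (intro add_right_mono mult_le_mono2) simp
    then show ?thesis by simp
  qed
  moreover have "digit p h L = (\<Sum>j<k. digit p (f j) L) mod p" for L
  proof (cases "L < M")
    case True
    then show ?thesis using s[of L] c assms(4) by (simp add: cong_def mod_power_eq_iff_digits[OF p])
  next
    case False
    then obtain l where l: "L = M + l" by (metis le_add_diff_inverse not_less)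
    have "digit p (f j) L = digit p (g j) l" for j
      unfolding f_def l using p by (intro digit_mult_add) auto
    then show ?thesis using g(2) by (simp add: l digit_div)
  qed
  ultimately show ?thesis using c by (auto simp: cong_def)
qed

section \<open>Counting beads in residue classes\<close>

text \<open>The residue is an integer, so that shifted classes such as r - j never truncate.\<close>

definition residue_card :: "nat set \<Rightarrow> nat \<Rightarrow> int \<Rightarrow> nat" where
  "residue_card S k r = card {z \<in> S. [int z = r] (mod int k)}"

text \<open>The \<open>L\<close>-th digit of \<open>\<psi>\<^sub>p\<close> before reduction modulo \<open>p\<close>: the number \<open>p ^ (ord + 1) - 1\<close> has digit
  \<open>p - 1 \<equiv> -1\<close> exactly in the positions \<open>L \<le> ord\<close>, so each pair congruent modulo \<open>p ^ L\<close>
  contributes \<open>-1\<close>.\<close>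

definition welter_digit :: "nat \<Rightarrow> nat set \<Rightarrow> nat \<Rightarrow> int" where
  "welter_digit p S L =
     (\<Sum>z\<in>S. int (digit p z L)) - (\<Sum>r<p ^ L. int (residue_card S (p ^ L) (int r) choose 2))"

text \<open>The change of \<open>welter_digit\<close> when a new bead x joins S: its own digit,
  minus one for each bead of S in its class.\<close>

definition bead_digit :: "nat \<Rightarrow> nat set \<Rightarrow> nat \<Rightarrow> nat \<Rightarrow> int" where
  "bead_digit p S x L = int (digit p x L) - int (residue_card S (p ^ L) (int x))"

text \<open>Runner r of an abacus with k runners, its beads renumbered by their quotients.\<close>

definition component :: "nat \<Rightarrow> nat \<Rightarrow> nat set \<Rightarrow> nat set" where
  "component k r S = {q. k * q + r \<in> S}"

lemma residue_card_cong:
  "[r = s] (mod int k) \<Longrightarrow> residue_card S k r = residue_card S k s"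
  by (simp add: residue_card_def cong_def)

lemma residue_card_1 [simp]: "residue_card S (Suc 0) r = card S"
  by (simp add: residue_card_def)

lemma residue_card_insert:
  assumes "finite S" "x \<notin> S"
  shows "residue_card (insert x S) k r = residue_card S k r + of_bool [int x = r] (mod int k)"
proof -
  have "{z \<in> insert x S. [int z = r] (mod int k)} =
    (if [int x = r] (mod int k) then insert x else id) {z \<in> S. [int z = r] (mod int k)}" by auto
  then show ?thesis using assms by (simp add: residue_card_def)
qed

text \<open>Only the class of x grows, and (c + 1) choose 2 exceeds c choose 2 by c.\<close>

lemma welter_digit_insert:
  assumes p: "p \<ge> 2" and "finite S" "x \<notin> S"
  shows "welter_digit p (insert x S) L = welter_digit p S L + bead_digit p S x L"
proof -
  let ?k = "p ^ L"
  let ?c = "\<lambda>r. residue_card S ?k (int r)"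
  have k: "?k > 0" using p by simp
  have eq: "[int x = int r] (mod int ?k) \<longleftrightarrow> r = x mod ?k" if "r < ?k" for r
    unfolding cong_int_iff using that by (auto simp: cong_def)
  have "(\<Sum>r<?k. int (residue_card (insert x S) ?k (int r) choose 2)) =
      (\<Sum>r<?k. int (?c r choose 2) + (if r = x mod ?k then int (?c (x mod ?k)) else 0))"
    using assms eq by (intro sum.cong) (auto simp: residue_card_insert numeral_2_eq_2)
  also have "\<dots> = (\<Sum>r<?k. int (?c r choose 2)) + int (?c (x mod ?k))"
    using k by (simp add: sum.distrib)
  also have "?c (x mod ?k) = residue_card S ?k (int x)"
    by (rule residue_card_cong) (simp only: cong_int_iff, simp add: cong_def)
  finally show ?thesis using assms by (simp add: welter_digit_def bead_digit_def)
qed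

lemma welter_digit_move:
  assumes "p \<ge> 2" "finite S" "x \<in> S" "y \<notin> S"
  shows "welter_digit p (insert y (S - {x})) L =
    welter_digit p S L + bead_digit p (S - {x}) y L - bead_digit p (S - {x}) x L"
  using welter_digit_insert[of p "S - {x}" x L] welter_digit_insert[of p "S - {x}" y L] assms
  by (simp add: insert_absorb)

lemma finite_component [simp]: "finite S \<Longrightarrow> k > 0 \<Longrightarrow> finite (component k r S)"
  unfolding component_def using finite_vimageI[of S "\<lambda>q. k * q + r"]
  by (simp add: vimage_def inj_def)

lemma residue_card_component:
  assumes "p \<ge> 2" "r < p ^ J"
  shows "residue_card (component (p ^ J) r S) (p ^ L) (int q)
    = residue_card S (p ^ (J + L)) (int (p ^ J * q + r))"
proof -
  let ?f = "\<lambda>q. p ^ J * q + r"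
  have *: "[?f z = ?f q] (mod p ^ (J + L)) \<longleftrightarrow> [z = q] (mod p ^ L)" for z
    using assms(1) unfolding cong_add_rcancel_nat
    by (simp add: power_add cong_def flip: mult_mod_right)
  have "{z \<in> S. [z = ?f q] (mod p ^ (J + L))} = ?f ` {z. ?f z \<in> S \<and> [z = q] (mod p ^ L)}"
  proof (intro equalityI subsetI)
    fix z assume z: "z \<in> {z \<in> S. [z = ?f q] (mod p ^ (J + L))}"
    then have "[z = ?f q] (mod p ^ J)"
      by (auto simp: power_add intro: cong_modulus_mult_nat)
    then have "z mod p ^ J = r" using assms(2) by (simp add: cong_def)
    then have zf: "z = ?f (z div p ^ J)" by (metis mult_div_mod_eq)
    then have "[?f (z div p ^ J) = ?f q] (mod p ^ (J + L))" using z by simp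
    then have "[z div p ^ J = q] (mod p ^ L)" by (subst (asm) *)
    moreover have "?f (z div p ^ J) \<in> S" using z zf by simp
    ultimately show "z \<in> ?f ` {z. ?f z \<in> S \<and> [z = q] (mod p ^ L)}"
      by (intro image_eqI[where f = ?f and x = "z div p ^ J", OF zf]) simp
  qed (auto simp: *)
  moreover have "inj ?f" using assms by (simp add: inj_def)
  ultimately show ?thesis
    unfolding residue_card_def component_def cong_int_iff mem_Collect_eq
    by (simp add: card_image inj_on_subset)
qed

text \<open>Passing to a runner removes J digits and divides the moduli by p^J, so upper digits can
  be computed on the runner of the bead alone. This drives the recursion in
  \<open>transfer_bead\<close>.\<close>

lemma bead_digit_component:
  assumes "p \<ge> 2" "r < p ^ J"
  shows "bead_digit p (component (p ^ J) r S) q L = bead_digit p S (p ^ J * q + r) (J + L)"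
  using assms by (simp add: bead_digit_def residue_card_component digit_mult_add)

lemma component_remove:
  assumes "r < k"
  shows "component k r (S - {k * q + r}) = component k r S - {q}"
  using assms by (auto simp: component_def)

lemma component_remove_other:
  assumes "r < k" "s < k" "r \<noteq> s"
  shows "component k r (S - {k * q + s}) = component k r S"
proof -
  have "k * z + r \<noteq> k * q + s" for z
    using assms by (metis mod_mult_self4 mod_less)
  then show ?thesis by (auto simp: component_def)
qed

lemma residue_card_split:
  assumes "finite S" "p > 0" "k > 0"
  shows "(\<Sum>t<p. residue_card S (p * k) (r + int t * int k)) = residue_card S k r"
proof -
  have disj: "t = t'" if "t < p" "t' < p" "[r + int t * int k = r + int t' * int k] (mod int (p * k))" for t t'
  proof -
    have "[t * k = t' * k] (mod (p * k))"
      using that(3) by (simp add: cong_add_lcancel cong_int_iff flip: of_nat_mult)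
    then show ?thesis using that assms(2,3) by (simp add: cong_def)
  qed
  have "(\<Sum>t<p. residue_card S (p * k) (r + int t * int k)) =
      card (\<Union>t<p. {z \<in> S. [int z = r + int t * int k] (mod int (p * k))})"
    unfolding residue_card_def
  proof (subst card_UN_disjoint)
    have "t = t'" if "t < p" "t' < p" "[int z = r + int t * int k] (mod int (p * k))"
      "[int z = r + int t' * int k] (mod int (p * k))" for t t' z
      using disj[OF that(1,2)] cong_trans[OF cong_sym[OF that(3)] that(4)] by blast
    then show "\<forall>i\<in>{..<p}. \<forall>j\<in>{..<p}. i \<noteq> j \<longrightarrow>
        {z \<in> S. [int z = r + int i * int k] (mod int (p * k))} \<inter>
        {z \<in> S. [int z = r + int j * int k] (mod int (p * k))} = {}"
      by blast
  qed (use assms(1) in auto)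
  also have "(\<Union>t<p. {z \<in> S. [int z = r + int t * int k] (mod int (p * k))}) =
      {z \<in> S. [int z = r] (mod int k)}"
  proof (intro equalityI subsetI)
    fix z assume "z \<in> {z \<in> S. [int z = r] (mod int k)}"
    then have z: "z \<in> S" "int k dvd int z - r" by (auto simp: cong_iff_dvd_diff)
    then obtain u where u: "int z = r + int k * u" by (metis dvd_def add_diff_cancel_left' diff_add_cancel add.commute)
    define t where "t = nat (u mod int p)"
    have "t < p" and t: "int t = u mod int p" using assms(2) by (simp_all add: t_def nat_less_iff)
    have "int z - (r + int t * int k) = int (p * k) * (u div int p)"
      by (simp add: u t minus_div_mult_eq_mod[symmetric] algebra_simps)
    then have "int (p * k) dvd int z - (r + int t * int k)" by (metis dvd_triv_left)
    with \<open>t < p\<close> show "z \<in> (\<Union>t<p. {z \<in> S. [int z = r + int t * int k] (mod int (p * k))})"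
      using z(1) by (auto simp: cong_iff_dvd_diff simp del: of_nat_mult)
  next
    fix z assume "z \<in> (\<Union>t<p. {z \<in> S. [int z = r + int t * int k] (mod int (p * k))})"
    then obtain t where z: "z \<in> S" "[int z = r + int t * int k] (mod int p * int k)" by auto
    from z(2) have "[int z = r + int t * int k] (mod int k)"
      by (intro cong_modulus_mult[of _ _ "int k" "int p"]) (simp add: mult.commute)
    then show "z \<in> {z \<in> S. [int z = r] (mod int k)}" using z(1) by (simp add: cong_def)
  qed
  finally show ?thesis by (simp add: residue_card_def)
qed

section \<open>Transferring a bead between runners\<close>

lemma card_component:
  assumes "r < k"
  shows "card (component k r S) = residue_card S k (int r)"
proof -
  let ?f = "\<lambda>q. k * q + r"
  have "{z \<in> S. [int z = int r] (mod int k)} = ?f ` component k r S"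
  proof (intro equalityI subsetI)
    fix z assume "z \<in> {z \<in> S. [int z = int r] (mod int k)}"
    then have "z \<in> S" "z mod k = r" using assms unfolding cong_int_iff by (auto simp: cong_def)
    then have "z = ?f (z div k)" by (metis mult_div_mod_eq)
    with \<open>z \<in> S\<close> show "z \<in> ?f ` component k r S"
      by (intro image_eqI[of _ _ "z div k"]) (simp_all add: component_def)
  qed (auto simp: component_def cong_int_iff cong_def)
  moreover have "inj_on ?f (component k r S)" using assms by (auto simp: inj_on_def)
  ultimately show ?thesis by (simp add: residue_card_def card_image)
qed

text \<open>Moving \<open>x\<close> from \<open>A\<close> to \<open>y\<close> in \<open>B\<close> without changing any digit shifts the last digit by
  \<open>s = card A - 1 - card B\<close>. If no residue class of \<open>A\<close> exceeded the class of \<open>B\<close> it is shifted to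
  (by one more where the shift wraps around), summing over the classes would give \<open>card A \<le> card B + s\<close>.\<close>

lemma transfer_bead:
  assumes p: "p \<ge> 2"
  shows "\<lbrakk>A \<subseteq> {..<p ^ K}; B \<subseteq> {..<p ^ K}; e \<le> 1; card B + e < card A\<rbrakk> \<Longrightarrow>
    \<exists>x\<in>A. \<exists>y. y + e \<le> x \<and> y \<notin> B \<and>
      (\<forall>L. [bead_digit p B y L = bead_digit p (A - {x}) x L] (mod int p))"
proof (induction K arbitrary: A B e)
  case 0
  then have "A \<subseteq> {0}" "B \<subseteq> {0}" by auto
  moreover have "card A \<le> 1" using card_mono[OF _ \<open>A \<subseteq> {0}\<close>] by simp
  ultimately have "A = {0}" "B = {}" "e = 0"
    using "0.prems"(4) by (auto simp: subset_singleton_iff)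
  then show ?case by auto
next
  case (Suc K)
  have fin: "finite A" "finite B" using Suc.prems finite_subset by blast+
  \<comment> \<open>Runner r of A is paired with runner \<open>f r\<close> of B, as the last digits
    require f r = r - s modulo p. A strict drop from x to y is wanted if e = 1. \<open>d r\<close>
    is the same demand on the quotients: it is made if the residue rises by wrapping around, or if
    \<sigma> = 0 leaves the residue fixed although e = 1.\<close>
  define s where "s = card A - 1 - card B"
  define \<sigma> where "\<sigma> = s mod p"
  define f where "f r = (r + p - \<sigma>) mod p" for r
  define d where "d r = (if r < \<sigma> \<or> \<sigma> < e then 1 else 0 :: nat)" for r
  have \<sigma>: "\<sigma> < p" using p by (simp add: \<sigma>_def)
  have s: "card A = Suc (card B + s)" "e \<le> s" using Suc.prems by (simp_all add: s_def)
  have f: "f r = (if r < \<sigma> then r + p - \<sigma> else r - \<sigma>)" if "r < p" for r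
    using that \<sigma> by (auto simp: f_def mod_if)
  have bij: "bij_betw f {..<p} {..<p}"
    by (intro bij_betw_byWitness[where f' = "\<lambda>r. if r + \<sigma> < p then r + \<sigma> else r + \<sigma> - p"])
      (use \<sigma> in \<open>auto simp: f split: if_splits\<close>)
  have split: "(\<Sum>r<p. card (component p r S)) = card S" if "finite S" for S
    using residue_card_split[OF that, of p 1 0] p by (simp add: card_component)
  have "\<exists>r<p. card (component p (f r) B) + d r < card (component p r A)"
  proof (rule ccontr)
    assume "\<not> ?thesis"
    then have "card A \<le> (\<Sum>r<p. card (component p (f r) B) + d r)"
      unfolding split[OF fin(1), symmetric] by (intro sum_mono) (meson lessThan_iff not_less)
    also have "\<dots> = card B + (\<Sum>r<p. d r)"
      using sum.reindex_bij_betw[OF bij, of "\<lambda>r. card (component p r B)"] split[OF fin(2)]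
      by (simp add: sum.distrib)
    \<comment> \<open>If \<sigma> < e, all p runners carry a demand, but then s is a positive
      multiple of p; otherwise exactly the \<sigma> wrapping runners do.\<close>
    also have "(\<Sum>r<p. d r) \<le> s"
    proof (cases "\<sigma> < e")
      case True
      then have "s mod p = 0" "s > 0" using Suc.prems(3) s(2) by (simp_all add: \<sigma>_def)
      then have "p dvd s" by (simp add: dvd_eq_mod_eq_0)
      then show ?thesis using True \<open>s > 0\<close> by (simp add: d_def dvd_imp_le)
    next
      case False
      then have "(\<Sum>r<p. d r) = card {r. r < p \<and> r < \<sigma>}" by (simp add: d_def sum.If_cases Int_def)
      also have "{r. r < p \<and> r < \<sigma>} = {..<\<sigma>}" using \<sigma> by auto
      finally show ?thesis by (simp add: \<sigma>_def)
    qed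
    finally show False using s(1) by simp
  qed
  then obtain r where r: "r < p" "card (component p (f r) B) + d r < card (component p r A)" by blast
  have fr: "f r < p" using p by (simp add: f_def)
  have bound: "component p r' S \<subseteq> {..<p ^ K}" if "S \<subseteq> {..<p ^ Suc K}" for r' S
  proof
    fix q assume "q \<in> component p r' S"
    then have "p * q + r' < p * p ^ K" using that by (auto simp: component_def)
    then have "p * q < p * p ^ K" by linarith
    then show "q \<in> {..<p ^ K}" by simp
  qed
  have dr: "d r \<le> 1" by (simp add: d_def)
  obtain q q' where q: "q \<in> component p r A" "q' + d r \<le> q" "q' \<notin> component p (f r) B"
    "\<And>L. [bead_digit p (component p (f r) B) q' L
        = bead_digit p (component p r A - {q}) q L] (mod int p)"
    using Suc.IH[OF bound[OF Suc.prems(1)] bound[OF Suc.prems(2)] dr r(2)] by blast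
  let ?x = "p * q + r" and ?y = "p * q' + f r"
  have xA: "?x \<in> A" "?y \<notin> B" using q by (auto simp: component_def)
  have le: "?y + e \<le> ?x"
  proof (cases "r < \<sigma> \<or> \<sigma> < e")
    case True
    then have "p * Suc q' \<le> p * q" using q(2) by (intro mult_le_mono2) (simp add: d_def)
    then show ?thesis using fr Suc.prems(3) by simp
  next
    case False
    then have "f r = r - \<sigma>" "\<sigma> \<le> r" "e \<le> \<sigma>" "q' \<le> q" using q(2) r(1) by (simp_all add: d_def f)
    moreover from this have "p * q' \<le> p * q" by (intro mult_le_mono2)
    ultimately show ?thesis by linarith
  qed
  have "[bead_digit p B ?y L = bead_digit p (A - {?x}) ?x L] (mod int p)" for L
  proof (cases L)
    case 0
    have "int p dvd int s - int \<sigma>" by (simp add: \<sigma>_def zmod_int minus_mod_eq_mult_div)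
    moreover have "int s - int r + int (f r) = int s - int \<sigma> + (if r < \<sigma> then int p else 0)"
      using f[OF r(1)] \<sigma> by auto
    ultimately have "int p dvd int s - int r + int (f r)" by (metis add_0_right dvd_add dvd_refl)
    moreover have "int (card A - 1) = int (card B) + int s" using s by simp
    ultimately have "int p dvd (int (f r) - int (card B)) - (int r - int (card A - 1))"
      by (simp add: algebra_simps)
    then show ?thesis using 0 fin(1) xA(1) r(1) fr
      by (simp add: bead_digit_def digit_0 cong_iff_dvd_diff)
  next
    case (Suc l)
    then show ?thesis
      using q(4)[of l] bead_digit_component[OF p, of "f r" 1 B q' l]
        bead_digit_component[OF p, of r 1 "A - {?x}" q l] r(1) fr
      by (simp add: component_remove)
  qed
  then show ?case using xA le by blast
qed

lemma mod_diff_small: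
  fixes r k j :: int
  assumes "0 \<le> j" "j < k"
  shows "(r - j) mod k = (if r mod k < j then r mod k - j + k else r mod k - j)"
proof -
  define m where "m = r mod k"
  have m: "0 \<le> m" "m < k" using assms by (simp_all add: m_def)
  have "(r - j) mod k = (m - j) mod k" by (simp add: m_def mod_diff_left_eq)
  also have "\<dots> = (m - j + (if m < j then k else 0)) mod k" by simp
  also have "\<dots> = m - j + (if m < j then k else 0)"
    using m assms by (intro mod_pos_pos_trivial) (auto split: if_splits)
  finally show ?thesis by (simp add: m_def)
qed

text \<open>\<open>transfer_bead\<close> is applied to the runners of r and r - j; digits from J on
  change only through these two. If r - j wraps around, the new residue is the larger one and the
  quotient has to drop strictly, which costs the additional bead in the hypothesis.\<close>

lemma bead_move:
  fixes j :: int
  assumes p: "p \<ge> 2" and S: "finite S" and j: "0 < j" "j < int (p ^ J)"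
    and less: "residue_card S (p ^ J) (r - j) + of_bool (r mod int (p ^ J) < j)
      < residue_card S (p ^ J) r"
  shows "\<exists>x\<in>S. \<exists>y<x. y \<notin> S \<and> [int x = r] (mod int (p ^ J)) \<and> [int y = r - j] (mod int (p ^ J)) \<and>
    (\<forall>L\<ge>J. [welter_digit p (insert y (S - {x})) L = welter_digit p S L] (mod int p))"
proof -
  let ?k = "p ^ J"
  define \<rho> \<rho>' where "\<rho> = nat (r mod int ?k)" and "\<rho>' = nat ((r - j) mod int ?k)"
  have k: "?k > 0" using p by simp
  have \<rho>: "int \<rho> = r mod int ?k" "int \<rho>' = (r - j) mod int ?k" "\<rho> < ?k" "\<rho>' < ?k"
    using k by (simp_all add: \<rho>_def \<rho>'_def nat_less_iff del: of_nat_power)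
  have ne: "\<rho> \<noteq> \<rho>'" "\<rho>' < \<rho> \<or> r mod int ?k < j"
    using mod_diff_small[of j "int ?k" r] j \<rho> by (auto split: if_splits)
  define e :: nat where "e = of_bool (r mod int ?k < j)"
  have e: "e \<le> 1" by (simp add: e_def)
  have "card (component ?k \<rho>' S) + e < card (component ?k \<rho> S)"
    using less \<rho> residue_card_cong[of "int \<rho>" r ?k S] residue_card_cong[of "int \<rho>'" "r - j" ?k S]
    by (simp add: card_component e_def cong_def)
  moreover obtain K where K: "component ?k \<rho> S \<subseteq> {..<p ^ K}" "component ?k \<rho>' S \<subseteq> {..<p ^ K}"
  proof -
    obtain b where b: "\<And>x. x \<in> component ?k \<rho> S \<union> component ?k \<rho>' S \<Longrightarrow> x < b"
      using finite_nat_set_iff_bounded[of "component ?k \<rho> S \<union> component ?k \<rho>' S"] S k by auto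
    have "b < p ^ b" using p less_le_trans[OF less_exp power_mono[of 2 p b]] by simp
    then show ?thesis using b by (intro that[of b]) (auto intro: less_trans)
  qed
  ultimately obtain q q' where q: "q \<in> component ?k \<rho> S" "q' + e \<le> q" "q' \<notin> component ?k \<rho>' S"
    "\<And>L. [bead_digit p (component ?k \<rho>' S) q' L = bead_digit p (component ?k \<rho> S - {q}) q L] (mod int p)"
    using transfer_bead[OF p K e] by blast
  let ?x = "?k * q + \<rho>" and ?y = "?k * q' + \<rho>'"
  have x: "?x \<in> S" "?y \<notin> S" using q by (auto simp: component_def)
  have "?y < ?x"
  proof (cases "e = 1")
    case True
    then have "?k * Suc q' \<le> ?k * q" using q(2) by (intro mult_le_mono2) simp
    then show ?thesis using \<rho>(4) by simp
  next
    case False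
    then have "\<rho>' < \<rho>" using ne(2) by (cases "r mod int ?k < j") (simp_all add: e_def)
    moreover have "?k * q' \<le> ?k * q" using q(2) by (intro mult_le_mono2) simp
    ultimately show ?thesis by (intro add_le_less_mono)
  qed
  moreover have "[welter_digit p (insert ?y (S - {?x})) L = welter_digit p S L] (mod int p)"
    if JL: "J \<le> L" for L
  proof -
    obtain l where l: "L = J + l" using JL by (auto simp: le_iff_add)
    have "bead_digit p (S - {?x}) ?y L = bead_digit p (component ?k \<rho>' S) q' l"
      using bead_digit_component[OF p \<rho>(4), of "S - {?x}" q' l] ne \<rho>
      by (simp add: l component_remove_other)
    moreover have "bead_digit p (S - {?x}) ?x L = bead_digit p (component ?k \<rho> S - {q}) q l"
      using bead_digit_component[OF p \<rho>(3), of "S - {?x}" q l] \<rho> by (simp add: l component_remove)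
    ultimately show ?thesis using q(4)[of l]
      unfolding welter_digit_move[OF p S x] by (simp add: cong_iff_dvd_diff)
  qed
  moreover have "[int ?x = r] (mod int ?k)" "[int ?y = r - j] (mod int ?k)"
    using \<rho>(1,2) by (simp_all add: cong_def)
  ultimately show ?thesis using x by blast
qed

section \<open>The digits of \<open>psi\<close> as bead counts\<close>

lemma welter_digit_set:
  assumes p: "p \<ge> 2"
  shows "distinct A \<Longrightarrow> welter_digit p (set A) L = (\<Sum>x\<leftarrow>A. int (digit p x L)) -
    (\<Sum>i<length A. \<Sum>j\<in>{i+1..<length A}. of_bool [int (A ! i) = int (A ! j)] (mod int (p ^ L)))"
proof (induction A rule: rev_induct)
  case Nil
  then show ?case by (simp add: welter_digit_def residue_card_def)
next
  case (snoc a A)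
  let ?n = "length A"
  let ?c = "\<lambda>x y. of_bool [int x = int y] (mod int (p ^ L)) :: int"
  have "(\<Sum>i<Suc ?n. \<Sum>j\<in>{i+1..<Suc ?n}. ?c ((A @ [a]) ! i) ((A @ [a]) ! j))
      = (\<Sum>i<?n. (\<Sum>j\<in>{i+1..<?n}. ?c (A ! i) (A ! j)) + ?c (A ! i) a)"
    by (simp add: nth_append)
  also have "\<dots> = (\<Sum>i<?n. \<Sum>j\<in>{i+1..<?n}. ?c (A ! i) (A ! j)) + (\<Sum>i<?n. ?c (A ! i) a)"
    by (rule sum.distrib)
  also have "(\<Sum>i<?n. ?c (A ! i) a) = (\<Sum>z\<in>set A. ?c z a)"
    using snoc.prems by (intro sum.reindex_bij_betw bij_betw_nth) auto
  also have "\<dots> = int (residue_card (set A) (p ^ L) (int a))"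
    by (simp add: residue_card_def of_bool_def sum.If_cases Int_def)
  finally show ?case
    using snoc welter_digit_insert[OF p, of "set A" a L] by (simp add: bead_digit_def)
qed

lemma sum_list_upt: "(\<Sum>i\<leftarrow>[a..<b]. f i) = sum f {a..<b :: nat}" for f :: "nat \<Rightarrow> nat"
  by (simp add: interv_sum_list_conv_sum_set_nat)

lemma sum_list_map_concat: "sum_list (map f (concat xss)) = (\<Sum>xs\<leftarrow>xss. sum_list (map f xs))"
  by (induction xss) simp_all

text \<open>This is the only place where the formula for \<open>psi\<close> is unfolded; from here
  on values are handled through their digits as bead counts.\<close>

lemma digit_psi:
  assumes p: "p \<ge> 2" and A: "distinct A"
  shows "int (digit p (psi p A) L) = welter_digit p (set A) L mod int p"
proof -
  let ?n = "length A"
  let ?c = "\<lambda>i j. [int (A ! i) = int (A ! j)] (mod int (p ^ L))"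
  define q where "q i j = p ^ (the_enat (ord_p p (int (A ! i) - int (A ! j))) + 1) - 1" for i j
  have q: "digit p (q i j) L = (p - 1) * of_bool (?c i j)" if ij: "i < ?n" "j \<in> {i+1..<?n}" for i j
  proof -
    have "A ! i \<noteq> A ! j" using A ij by (auto simp: nth_eq_iff_index_eq)
    then have ne: "int (A ! i) - int (A ! j) \<noteq> 0" by simp
    have "L < multiplicity (int p) (int (A ! i) - int (A ! j)) + 1 \<longleftrightarrow> ?c i j"
      using power_dvd_iff_le_multiplicity[OF ne, of "int p" L] p
      by (simp add: cong_iff_dvd_diff less_Suc_eq_le)
    then show ?thesis
      unfolding q_def digit_power_minus_one[OF p] using ne by (simp add: ord_p_def)
  qed
  have "psi p A = nim_add p (nim_sum p A)
      (nim_sum p (concat (map (\<lambda>i. map (q i) [i+1..<?n]) [0..<?n])))"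
    by (simp add: psi_def q_def[abs_def])
  then have "digit p (psi p A) L = ((\<Sum>x\<leftarrow>A. digit p x L) mod p +
      (\<Sum>y\<leftarrow>concat (map (\<lambda>i. map (q i) [i+1..<?n]) [0..<?n]). digit p y L) mod p) mod p"
    by (simp only: digit_nim_add[OF p] digit_nim_sum[OF p])
  also have "(\<Sum>y\<leftarrow>concat (map (\<lambda>i. map (q i) [i+1..<?n]) [0..<?n]). digit p y L)
      = (\<Sum>i<?n. \<Sum>j\<in>{i+1..<?n}. digit p (q i j) L)"
    by (simp add: sum_list_map_concat sum_list_upt atLeast0LessThan o_def)
  also have "\<dots> = (p - 1) * (\<Sum>i<?n. \<Sum>j\<in>{i+1..<?n}. of_bool (?c i j))"
    unfolding sum_distrib_left using q by (intro sum.cong refl) simp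
  finally have "int (digit p (psi p A) L) = (int (\<Sum>x\<leftarrow>A. digit p x L) +
      (int p - 1) * (\<Sum>i<?n. \<Sum>j\<in>{i+1..<?n}. of_bool (?c i j))) mod int p"
    using p by (simp add: mod_add_eq zmod_int of_nat_diff)
  also have "\<dots> = (int (\<Sum>x\<leftarrow>A. digit p x L) -
      (\<Sum>i<?n. \<Sum>j\<in>{i+1..<?n}. of_bool (?c i j))) mod int p"
    by (simp add: left_diff_distrib mod_simps cong_def[symmetric] cong_iff_dvd_diff)
  also have "int (\<Sum>x\<leftarrow>A. digit p x L) = (\<Sum>x\<leftarrow>A. int (digit p x L))"
    by (induction A) simp_all
  finally show ?thesis unfolding welter_digit_set[OF p A] .
qed

section \<open>Residue counts and value of an initial segment\<close>

text \<open>Translation by one carries the class of r - 1 in {..<m} to the class of r in {1..m};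
  only the end points 0 and m make a difference.\<close>

lemma residue_card_lessThan_diff:
  "int (residue_card {..<m} k r) = int (residue_card {..<m} k (r - 1))
     + of_bool (int k dvd r) - of_bool (int k dvd r - int m)"
proof (induction m)
  case (Suc m)
  have "[int m = r] (mod int k) \<longleftrightarrow> int k dvd r - int m"
    "[int m = r - 1] (mod int k) \<longleftrightarrow> int k dvd r - int (Suc m)"
    unfolding cong_iff_dvd_diff by (subst dvd_diff_commute, simp add: algebra_simps)+
  then show ?case using Suc by (simp add: lessThan_Suc residue_card_insert)
qed (simp add: residue_card_def)

text \<open>Among fewer than k consecutive steps down, a gain occurs only at a multiple of k, hence
  at most once. So {..<m} is itself blocked in the sense of \<open>stuck\<close> in
  \<open>balanced_step\<close>.\<close>

lemma residue_card_lessThan_shift: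
  assumes "k > 0"
  shows "j < k \<Longrightarrow> residue_card {..<m} k r
    \<le> residue_card {..<m} k (r - int j) + of_bool (r mod int k < int j)"
proof (induction j)
  case (Suc j)
  have "int k dvd r - int j \<longleftrightarrow> r mod int k = int j"
    using Suc.prems by (simp flip: cong_iff_dvd_diff add: cong_def)
  then show ?case
    using Suc residue_card_lessThan_diff[of m k "r - int j"] by (auto simp: of_bool_def algebra_simps split: if_splits)
qed simp

lemma residue_card_lessThan_self:
  assumes "k > 0"
  shows "residue_card {..<m} k (int m) = m div k"
proof -
  have "{z \<in> {..<m}. [z = m] (mod k)} = (\<lambda>i. k * i + m mod k) ` {..<m div k}"
  proof (intro equalityI subsetI)
    fix z assume z: "z \<in> {z \<in> {..<m}. [z = m] (mod k)}"
    then have "z mod k = m mod k" "z < m" by (auto simp: cong_def)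
    then have "k * (z div k) + m mod k < k * (m div k) + m mod k" by (metis mult_div_mod_eq)
    then have "k * (z div k) < k * (m div k)" by (rule add_less_imp_less_right)
    then have "z div k < m div k" by simp
    moreover have "z = k * (z div k) + m mod k" using \<open>z mod k = m mod k\<close> by (metis mult_div_mod_eq)
    ultimately show "z \<in> (\<lambda>i. k * i + m mod k) ` {..<m div k}" by blast
  next
    fix z assume "z \<in> (\<lambda>i. k * i + m mod k) ` {..<m div k}"
    then obtain i where i: "i < m div k" "z = k * i + m mod k" by auto
    then have "k * i < k * (m div k)" using assms by simp
    then have "z < k * (m div k) + m mod k" unfolding i(2) by (rule add_strict_right_mono)
    then show "z \<in> {z \<in> {..<m}. [z = m] (mod k)}" using i by (simp add: cong_def)
  qed
  moreover have "inj (\<lambda>i. k * i + m mod k)" using assms by (simp add: inj_def)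
  ultimately show ?thesis
    unfolding residue_card_def cong_int_iff by (simp add: card_image inj_on_subset)
qed

text \<open>The new bead m has digit (m div p^L) mod p and exactly m div p^L congruent partners
  below it, so its contribution cancels modulo p.\<close>

lemma welter_digit_lessThan:
  assumes p: "p \<ge> 2"
  shows "[welter_digit p {..<m} L = 0] (mod int p)"
proof (induction m)
  case 0
  then show ?case by (simp add: welter_digit_def residue_card_def binomial_eq_0)
next
  case (Suc m)
  have "bead_digit p {..<m} m L = int ((m div p ^ L) mod p) - int (m div p ^ L)"
    using p by (simp add: bead_digit_def residue_card_lessThan_self digit_def)
  then have "[bead_digit p {..<m} m L = 0] (mod int p)"
    by (simp add: cong_def zmod_int mod_simps)
  then show ?case
    using Suc welter_digit_insert[OF p, of "{..<m}" m L] cong_add[OF Suc]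
    by (fastforce simp: lessThan_Suc)
qed

section \<open>Residue counts of blocked positions\<close>

text \<open>Floor division continues digits to negative s, as needed for s = r - 1 or s = x -
  p^L.\<close>

lemma digit_cong:
  assumes "p \<ge> 2" "[int y = s] (mod int (p ^ Suc l))"
  shows "[int (digit p y l) = s div int (p ^ l)] (mod int p)"
proof -
  obtain u where "int y = s + int (p ^ Suc l) * u"
    using assms(2) by (metis cong_iff_lin cong_sym)
  then have "int y = s + int (p ^ l) * (int p * u)" by (simp add: algebra_simps)
  then have "int y div int (p ^ l) = int p * u + s div int (p ^ l)"
    using assms(1) by (simp only: div_mult_self2) simp
  then show ?thesis by (simp add: int_digit cong_def)
qed

text \<open>Digit L depends only on the residue modulo p^(L+1). This expresses digit sums through
  class counts, in which S and {..<m} can be compared.\<close>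

lemma sum_digit_eq:
  assumes p: "p \<ge> 2" and S: "finite S"
  shows "(\<Sum>z\<in>S. int (digit p z L)) =
    (\<Sum>r<p ^ Suc L. int (digit p r L) * int (residue_card S (p ^ Suc L) (int r)))"
proof -
  let ?k = "p ^ Suc L"
  have k: "?k > 0" using p by simp
  have "(\<Sum>z\<in>S. int (digit p z L)) = (\<Sum>r<?k. \<Sum>z\<in>{z\<in>S. z mod ?k = r}. int (digit p z L))"
    by (rule sum.group[symmetric]) (use S k in auto)
  also have "\<dots> = (\<Sum>r<?k. int (digit p r L) * int (residue_card S ?k (int r)))"
  proof (intro sum.cong refl)
    fix r assume r: "r \<in> {..<?k}"
    have eq: "{z \<in> S. [int z = int r] (mod int ?k)} = {z \<in> S. z mod ?k = r}"
      unfolding cong_int_iff using r by (simp add: cong_def)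
    have "digit p z L = digit p r L" if "z mod ?k = r" for z
      using that r mod_power_eq_iff_digits[OF p, of z "Suc L" r] by simp
    then show "(\<Sum>z\<in>{z\<in>S. z mod ?k = r}. int (digit p z L))
        = int (digit p r L) * int (residue_card S ?k (int r))"
      unfolding residue_card_def eq by simp
  qed
  finally show ?thesis .
qed

text \<open>Such a sequence takes a value c + 1 for a while and then c, so its sum determines it. In
  the proof, one strict inequality h t < k t spreads to h \<le> k everywhere, because the total drop
  of each sequence is at most one.\<close>

lemma almost_constant_unique:
  fixes f g :: "nat \<Rightarrow> nat"
  assumes f: "\<And>t. Suc t < p \<Longrightarrow> f (Suc t) \<le> f t" "f 0 \<le> Suc (f (p - 1))"
    and g: "\<And>t. Suc t < p \<Longrightarrow> g (Suc t) \<le> g t" "g 0 \<le> Suc (g (p - 1))"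
    and sum: "sum f {..<p} = sum g {..<p}" and t: "t < p"
  shows "f t = g t"
proof -
  have anti: "h b \<le> h a" if "a \<le> b" "b < p" "\<And>t. Suc t < p \<Longrightarrow> h (Suc t) \<le> h t"
    for h :: "nat \<Rightarrow> nat" and a b
    using that(1,2)
  proof (induction b)
    case (Suc b)
    then show ?case using that(3)[of b] by (cases "a = Suc b") auto
  qed simp
  have False if h: "\<And>t. Suc t < p \<Longrightarrow> h (Suc t) \<le> h t" "h 0 \<le> Suc (h (p - 1))"
    and k: "\<And>t. Suc t < p \<Longrightarrow> k (Suc t) \<le> k t" "k 0 \<le> Suc (k (p - 1))"
    and sum': "sum h {..<p} = sum k {..<p}" and less: "h t < k t" for h k :: "nat \<Rightarrow> nat"
  proof -
    have "h s \<le> k s" if s: "s < p" for s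
    proof (cases "s \<le> t")
      case True
      have "h s \<le> h 0" "h (p - 1) \<le> h t" "k t \<le> k s"
        using anti[of 0 s h] anti[of t "p - 1" h] anti[of s t k] h k s t True by auto
      then show ?thesis using h(2) less by linarith
    next
      case False
      have "h s \<le> h t" "k t \<le> k 0" "k (p - 1) \<le> k s"
        using anti[of t s h] anti[of 0 t k] anti[of s "p - 1" k] h k s t False by auto
      then show ?thesis using k(2) less by linarith
    qed
    then have "sum h {..<p} < sum k {..<p}"
      using t less by (intro sum_strict_mono_ex1) auto
    then show False using sum' by simp
  qed
  from this[OF f g sum] this[OF g f sum[symmetric]] show ?thesis by (meson nat_neq_iff)
qed

text \<open>\<open>stuck\<close> says that no bead of a residue class modulo \<open>p ^ L\<close> can be moved by \<open>bead_move\<close> with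
  \<open>j = p ^ L\<close>; as for a \<open>p\<close>-core that is empty, this determines the class sizes.\<close>

lemma balanced_step:
  assumes p: "p \<ge> 2" and S: "finite S"
    and IH: "\<And>r. residue_card S (p ^ L) r = residue_card {..<m} (p ^ L) r"
    and stuck: "\<And>r. residue_card S (p ^ Suc L) r \<le> residue_card S (p ^ Suc L) (r - int (p ^ L))
      + of_bool (r mod int (p ^ Suc L) < int (p ^ L))"
  shows "residue_card S (p ^ Suc L) r = residue_card {..<m} (p ^ Suc L) r"
proof -
  let ?P = "p ^ L" and ?k = "p ^ Suc L"
  \<comment> \<open>The class of r is the t-th of the p classes modulo p^(L+1) into which the class
    of \<kappa> modulo p^L splits.\<close>
  define \<kappa> where "\<kappa> = r mod int ?P"
  define t where "t = nat ((r div int ?P) mod int p)"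
  have P: "int ?P > 0" "?P < ?k" using p by simp_all
  have \<kappa>: "0 \<le> \<kappa>" "\<kappa> < int ?P" unfolding \<kappa>_def using P(1) by simp_all
  have t: "t < p" "int t = (r div int ?P) mod int p" using p by (simp_all add: t_def nat_less_iff)
  have r: "[r = \<kappa> + int t * int ?P] (mod int ?k)"
  proof -
    have "r = int ?P * (r div int ?P) + \<kappa>" by (simp add: \<kappa>_def)
    also have "r div int ?P = int p * (r div int ?P div int p) + int t" by (simp add: t)
    finally have "r - (\<kappa> + int t * int ?P) = int ?k * (r div int ?P div int p)"
      by (simp add: algebra_simps)
    then show ?thesis unfolding cong_iff_dvd_diff by (metis dvd_triv_left)
  qed
  \<comment> \<open>\<open>stuck\<close> is read along these p classes: there is no increase from
    one to the next, and the first exceeds the last by at most one. It is stated for any h because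
    the counts of S and of {..<m} both obey it.\<close>
  have steps: "h (\<kappa> + int (Suc s) * int ?P) \<le> h (\<kappa> + int s * int ?P)" "h \<kappa> \<le> Suc (h (\<kappa> + int (p - 1) * int ?P))"
    if h: "\<And>r. h r \<le> h (r - int ?P) + of_bool (r mod int ?k < int ?P)"
      and per: "\<And>r r'. [r = r'] (mod int ?k) \<Longrightarrow> h r = h r'" and s: "Suc s < p"
    for h :: "int \<Rightarrow> nat" and s
  proof -
    have "int (Suc (Suc s)) * int ?P \<le> int p * int ?P" using s by (intro mult_right_mono) auto
    then have "\<kappa> + int (Suc s) * int ?P < int ?k" using \<kappa> by (simp add: algebra_simps)
    then have "(\<kappa> + int (Suc s) * int ?P) mod int ?k = \<kappa> + int (Suc s) * int ?P"
      using \<kappa> P by (intro mod_pos_pos_trivial) (auto simp: algebra_simps)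
    moreover have "\<kappa> + int (Suc s) * int ?P \<ge> int ?P" using \<kappa> P by (simp add: algebra_simps)
    ultimately show "h (\<kappa> + int (Suc s) * int ?P) \<le> h (\<kappa> + int s * int ?P)"
      using h[of "\<kappa> + int (Suc s) * int ?P"] by (simp add: algebra_simps)
    have "[\<kappa> - int ?P = \<kappa> + int (p - 1) * int ?P] (mod int ?k)"
      using p by (simp add: cong_iff_dvd_diff of_nat_diff algebra_simps)
    from per[OF this] show "h \<kappa> \<le> Suc (h (\<kappa> + int (p - 1) * int ?P))"
      using h[of \<kappa>] by (cases "\<kappa> mod int ?k < int ?P") simp_all
  qed
  let ?f = "\<lambda>t. residue_card S ?k (\<kappa> + int t * int ?P)"
  let ?g = "\<lambda>t. residue_card {..<m} ?k (\<kappa> + int t * int ?P)"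
  have g: "residue_card {..<m} ?k r \<le> residue_card {..<m} ?k (r - int ?P) + of_bool (r mod int ?k < int ?P)" for r
    using P by (intro residue_card_lessThan_shift) auto
  have "?f t = ?g t"
  proof (rule almost_constant_unique[where f = ?f and g = ?g, OF _ _ _ _ _ t(1)])
    show "sum ?f {..<p} = sum ?g {..<p}"
      using residue_card_split[OF S, of p ?P \<kappa>] residue_card_split[of "{..<m}" p ?P \<kappa>] IH p by simp
    show "?f (Suc s) \<le> ?f s" if "Suc s < p" for s
      by (rule steps(1)[OF stuck residue_card_cong]) (use that in auto)
    show "?g (Suc s) \<le> ?g s" if "Suc s < p" for s
      by (rule steps(1)[OF g residue_card_cong]) (use that in auto)
    show "?f 0 \<le> Suc (?f (p - 1))"
      using steps(2)[OF stuck residue_card_cong, where s = 0] p by simp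
    show "?g 0 \<le> Suc (?g (p - 1))"
      using steps(2)[OF g residue_card_cong, where s = 0] p by simp
  qed
  then show ?thesis by (simp only: residue_card_cong[OF r])
qed

section \<open>Lowering the value by one\<close>

text \<open>In the application d is the excess of the class counts of a blocked position over those
  of {..<m}. It turns out constant on runs of p consecutive residues; once the weight is constant on
  these runs too, each of them contributes a multiple of p.\<close>

lemma weighted_digit_sum:
  fixes d :: "int \<Rightarrow> int"
  assumes p: "p \<ge> 2" and N: "N > 0"
    and per: "\<And>r s. [r = s] (mod int (p ^ Suc N)) \<Longrightarrow> d r = d s"
    and fibre: "\<And>r. (\<Sum>t<p. d (r + int t * int (p ^ N))) = 0"
    and run: "\<And>r. \<not> int p dvd r - m \<Longrightarrow> d r \<le> d (r - 1)"
  shows "[(\<Sum>\<rho><p ^ Suc N. (int \<rho> div int (p ^ N)) * d (int \<rho>)) = 0] (mod int p)"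
proof -
  define P K where "P = int (p ^ N)" and "K = int (p ^ Suc N)"
  have P: "P > 0" "K = int p * P" "K > 0" using p by (simp_all add: P_def K_def)
  have pP: "int p dvd P" using N by (simp add: P_def)
  \<comment> \<open>Since p divides p^N, \<open>run\<close> applies at all p points of the fibre of
    r. Both fibre sums vanish, so every one of these inequalities is an equality.\<close>
  have run_eq: "d r = d (r - 1)" if r: "\<not> int p dvd r - m" for r
  proof -
    have "\<not> int p dvd (r + int t * P) - m" for t
    proof -
      have "(r + int t * P) - m = (r - m) + int t * P" by simp
      then show ?thesis using r pP by (metis dvd_add_left_iff dvd_mult)
    qed
    then have le: "0 \<le> d (r - 1 + int t * P) - d (r + int t * P)" for t
      using run[of "r + int t * P"] by (simp add: algebra_simps)
    have "(\<Sum>t<p. d (r - 1 + int t * P) - d (r + int t * P)) = 0"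
      using fibre[of r] fibre[of "r - 1"] by (simp add: sum_subtractf P_def)
    then have "\<forall>t\<in>{..<p}. d (r - 1 + int t * P) - d (r + int t * P) = 0"
      using le by (subst (asm) sum_nonneg_eq_0_iff) auto
    then show ?thesis using p by (auto dest: bspec[of _ _ 0])
  qed
  \<comment> \<open>The difference of the weights r div P and (r - m) div P is P-periodic, hence
    constant on fibres and annihilated by the fibre sums.\<close>
  define u where "u r = r div P - (r - m) div P" for r
  have u: "u (r + t * P) = u r" for r t
  proof -
    have eq: "r + t * P - m = (r - m) + t * P" by simp
    show ?thesis unfolding u_def eq using P(1) by simp
  qed
  have "(\<Sum>\<rho><p ^ Suc N. u (int \<rho>) * d (int \<rho>)) =
      (\<Sum>t<p. \<Sum>\<rho>\<in>{t * p ^ N..<t * p ^ N + p ^ N}. u (int \<rho>) * d (int \<rho>))"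
    by (simp add: sum.nat_group)
  also have "\<dots> = (\<Sum>t<p. \<Sum>\<kappa><p ^ N. u (int \<kappa>) * d (int \<kappa> + int t * P))"
  proof (rule sum.cong[OF refl])
    fix t
    have eq: "int (\<kappa> + t * p ^ N) = int \<kappa> + int t * P" for \<kappa> by (simp add: P_def)
    have "(\<Sum>\<rho>\<in>{0 + t * p ^ N..<p ^ N + t * p ^ N}. u (int \<rho>) * d (int \<rho>)) =
        (\<Sum>\<kappa>\<in>{0..<p ^ N}. u (int \<kappa>) * d (int \<kappa> + int t * P))"
      by (simp only: sum.shift_bounds_nat_ivl eq u)
    then show "(\<Sum>\<rho>\<in>{t * p ^ N..<t * p ^ N + p ^ N}. u (int \<rho>) * d (int \<rho>)) =
        (\<Sum>\<kappa><p ^ N. u (int \<kappa>) * d (int \<kappa> + int t * P))"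
      by (simp add: atLeast0LessThan add.commute)
  qed
  also have "\<dots> = (\<Sum>\<kappa><p ^ N. u (int \<kappa>) * (\<Sum>t<p. d (int \<kappa> + int t * P)))"
    by (subst sum.swap) (simp add: sum_distrib_left)
  also have "\<dots> = 0" using fibre by (simp add: P_def)
  finally have sum_u: "(\<Sum>\<rho><p ^ Suc N. u (int \<rho>) * d (int \<rho>)) = 0" .
  \<comment> \<open>In the coordinate \<sigma> = \<rho> - m modulo K the runs are the blocks
    starting at multiples of p. As p divides P, the weight \<sigma> div P is constant on each
    block.\<close>
  define G where "G \<sigma> = (int \<sigma> div P) * d (m + int \<sigma>)" for \<sigma>
  define h where "h \<rho> = nat ((int \<rho> - m) mod K)" for \<rho>
  have h: "int (h \<rho>) = (int \<rho> - m) mod K" for \<rho> using P by (simp add: h_def)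
  have hb: "bij_betw h {..<p ^ Suc N} {..<p ^ Suc N}"
  proof -
    have "inj_on h {..<p ^ Suc N}"
    proof (rule inj_onI)
      fix a b assume ab: "a \<in> {..<p ^ Suc N}" "b \<in> {..<p ^ Suc N}" "h a = h b"
      then have "[int a - m = int b - m] (mod K)" using h by (metis cong_def)
      then have "[a = b] (mod p ^ Suc N)"
        unfolding K_def by (metis cong_add_rcancel diff_add_cancel cong_int_iff)
      then show "a = b" using ab by (simp add: cong_def)
    qed
    moreover have "h ` {..<p ^ Suc N} \<subseteq> {..<p ^ Suc N}"
      using P(3) by (auto simp: h_def nat_less_iff K_def)
    ultimately show ?thesis by (simp add: bij_betw_def endo_inj_surj)
  qed
  have "[((int \<rho> - m) div P) * d (int \<rho>) = G (h \<rho>)] (mod int p)" for \<rho>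
  proof -
    define x where "x = int \<rho> - m"
    have "P * (int p * (x div K)) = K * (x div K)" by (simp add: P(2))
    then have "x = P * (int p * (x div K)) + x mod K" by (simp only: mult_div_mod_eq)
    then have "x div P = int p * (x div K) + (x mod K) div P"
      using P(1) by (metis add.commute div_mult_self2 less_irrefl)
    then have "[x div P = (x mod K) div P] (mod int p)" by (simp add: cong_def)
    moreover have "d (int \<rho>) = d (m + x mod K)"
      by (rule per) (simp add: x_def cong_def mod_simps K_def)
    ultimately show ?thesis by (simp add: G_def h x_def cong_scalar_right)
  qed
  then have "[(\<Sum>\<rho><p ^ Suc N. ((int \<rho> - m) div P) * d (int \<rho>)) = (\<Sum>\<rho><p ^ Suc N. G (h \<rho>))] (mod int p)"
    by (rule cong_sum)
  also have "(\<Sum>\<rho><p ^ Suc N. G (h \<rho>)) = (\<Sum>\<sigma><p ^ Suc N. G \<sigma>)"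
    by (rule sum.reindex_bij_betw[OF hb])
  also have "\<dots> = (\<Sum>\<alpha><p ^ N. \<Sum>\<sigma>\<in>{\<alpha> * p..<\<alpha> * p + p}. G \<sigma>)"
    by (simp add: sum.nat_group mult.commute)
  also have "\<dots> = (\<Sum>\<alpha><p ^ N. int p * G (\<alpha> * p))"
  proof (intro sum.cong refl)
    fix \<alpha>
    have "G (\<alpha> * p + j) = G (\<alpha> * p)" if "j < p" for j
    proof -
      have "d (m + int (\<alpha> * p + j)) = d (m + int (\<alpha> * p))"
        using that
      proof (induction j)
        case (Suc j)
        have "\<not> p dvd \<alpha> * p + Suc j" using Suc.prems nat_dvd_not_less[of "Suc j" p]
          by (metis dvd_add_right_iff dvd_triv_right zero_less_Suc)
        then have "\<not> int p dvd (m + int (\<alpha> * p + Suc j)) - m" by (simp only: add_diff_cancel_left' int_dvd_int_iff not_False_eq_True)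
        then show ?case using run_eq[of "m + int (\<alpha> * p + Suc j)"] Suc by (simp add: algebra_simps)
      qed simp
      moreover obtain N' where "N = Suc N'" using N gr0_conv_Suc by blast
      then have "(\<alpha> * p + j) div p ^ N = (\<alpha> * p) div p ^ N" using that by (simp add: div_mult2_eq)
      then have "int (\<alpha> * p + j) div P = int (\<alpha> * p) div P"
        unfolding P_def by (simp only: zdiv_int[symmetric])
      ultimately show ?thesis by (simp only: G_def)
    qed
    then have "(\<Sum>\<sigma>\<in>{0 + \<alpha> * p..<p + \<alpha> * p}. G \<sigma>) = (\<Sum>j\<in>{0..<p}. G (\<alpha> * p))"
      unfolding sum.shift_bounds_nat_ivl by (intro sum.cong) (auto simp: add.commute)
    then show "(\<Sum>\<sigma>\<in>{\<alpha> * p..<\<alpha> * p + p}. G \<sigma>) = int p * G (\<alpha> * p)"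
      by (simp add: add.commute)
  qed
  also have "\<dots> = int p * (\<Sum>\<alpha><p ^ N. G (\<alpha> * p))" by (simp add: sum_distrib_left)
  finally have "[(\<Sum>\<rho><p ^ Suc N. ((int \<rho> - m) div P) * d (int \<rho>)) = 0] (mod int p)"
    by (simp add: cong_def)
  moreover have "(\<Sum>\<rho><p ^ Suc N. (int \<rho> div P) * d (int \<rho>)) =
      (\<Sum>\<rho><p ^ Suc N. ((int \<rho> - m) div P) * d (int \<rho>)) + (\<Sum>\<rho><p ^ Suc N. u (int \<rho>) * d (int \<rho>))"
    unfolding sum.distrib[symmetric] by (intro sum.cong) (simp_all add: u_def algebra_simps)
  ultimately show ?thesis using sum_u by (simp only: P_def add_0_right)
qed


lemma div_diff_one:
  fixes r k :: int
  assumes "k > 0"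
  shows "(r - 1) div k = r div k - of_bool (k dvd r)"
proof -
  have "r - 1 = (r mod k - 1) + (r div k) * k" by (simp add: algebra_simps)
  then have "(r - 1) div k = r div k + (r mod k - 1) div k"
    using assms by (metis div_mult_self1 less_irrefl)
  moreover have "(r mod k - 1) div k = - of_bool (k dvd r)"
  proof (cases "k dvd r")
    case True
    then show ?thesis using assms by (simp add: div_eq_minus1)
  next
    case False
    have "0 \<le> r mod k" "r mod k < k" using assms by simp_all
    moreover have "r mod k \<noteq> 0" using False by (simp add: dvd_eq_mod_eq_0)
    ultimately have "0 \<le> r mod k - 1" "r mod k - 1 < k" by linarith+
    then show ?thesis using False by (simp add: div_pos_pos_trivial)
  qed
  ultimately show ?thesis by simp
qed

text \<open>Let \<open>N\<close> be the lowest nonzero digit of the value \<open>n\<close>. A move by \<open>j = p ^ L\<close> with \<open>L < N\<close> turns a digit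
  \<open>0\<close> into \<open>p - 1\<close>, so it raises the value. If all these moves are blocked, then \<open>S\<close> has the residue
  counts of \<open>{..<m}\<close> modulo \<open>p ^ N\<close>, and a move by \<open>j = 1\<close> in a class \<open>r \<noteq> m\<close> modulo \<open>p\<close> gives exactly
  \<open>n - 1\<close>. If these are blocked as well, then \<open>weighted_digit_sum\<close> shows that digit \<open>N\<close> vanishes.\<close>

lemma descend:
  assumes p: "p \<ge> 2" and S: "finite S"
    and n: "\<And>L. int (digit p n L) = welter_digit p S L mod int p" and "n > 0"
  shows "\<exists>x\<in>S. \<exists>y<x. y \<notin> S \<and>
    (\<forall>n'. (\<forall>L. int (digit p n' L) = welter_digit p (insert y (S - {x})) L mod int p) \<longrightarrow> n \<le> Suc n')"
proof (rule ccontr)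
  assume "\<not> ?thesis"
  then have neg: "\<exists>n'. (\<forall>L. int (digit p n' L) = welter_digit p (insert y (S - {x})) L mod int p) \<and> Suc n' < n"
    if "x \<in> S" "y < x" "y \<notin> S" for x y
    using that by (meson not_le)
  define N where "N = (LEAST L. digit p n L \<noteq> 0)"
  have "\<exists>L. digit p n L \<noteq> 0"
  proof (rule ccontr)
    assume "\<not> ?thesis"
    then have "digit p n L = digit p 0 L" for L by (simp add: digit_def)
    from digit_eqI[OF p this] show False using \<open>n > 0\<close> by simp
  qed
  then have N: "digit p n N \<noteq> 0" "\<And>L. L < N \<Longrightarrow> digit p n L = 0"
    unfolding N_def by (metis (mono_tags, lifting) LeastI) (use not_less_Least in blast)
  define m where "m = card S"
  have lower: "int (digit p n' L) = (int (digit p n L) - 1) mod int p"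
    if "\<forall>L. int (digit p n' L) = welter_digit p (insert y (S - {x})) L mod int p"
      "[welter_digit p (insert y (S - {x})) L = welter_digit p S L - 1] (mod int p)" for n' x y L
    using that n[of L] by (simp add: cong_def mod_simps)
  have same: "digit p n' L = digit p n L"
    if "\<forall>L. int (digit p n' L) = welter_digit p (insert y (S - {x})) L mod int p"
      "[welter_digit p (insert y (S - {x})) L = welter_digit p S L] (mod int p)" for n' x y L
    using that n[of L] by (metis cong_def of_nat_eq_iff)
  have pred_0: "d = p - 1" if "int d = (0 - 1) mod int p" for d
  proof -
    have "(- 1) mod int p = int p - 1" using p by (simp add: zmod_minus1)
    then show ?thesis using that p by simp
  qed
  have pred_pos: "Suc d = e" if "int d = (int e - 1) mod int p" "e \<noteq> 0" "e < p" for d e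
    using that by (simp add: mod_pos_pos_trivial)
  \<comment> \<open>L = 0 is covered even if N = 0: the move by 1 then lowers the nonzero last digit
    by one and leaves all others, which gives n - 1.\<close>
  have stuck: "residue_card S (p ^ Suc L) r \<le> residue_card S (p ^ Suc L) (r - int (p ^ L))
      + of_bool (r mod int (p ^ Suc L) < int (p ^ L))" if L: "L < N \<or> L = 0" for L r
  proof (rule ccontr)
    assume "\<not> ?thesis"
    then obtain x y where xy: "x \<in> S" "y < x" "y \<notin> S" "[int x = r] (mod int (p ^ Suc L))"
      "[int y = r - int (p ^ L)] (mod int (p ^ Suc L))"
      "\<forall>l\<ge>Suc L. [welter_digit p (insert y (S - {x})) l = welter_digit p S l] (mod int p)"
      using bead_move[OF p S, of "int (p ^ L)" "Suc L" r] p by (auto simp: not_le)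
    from neg[OF xy(1-3)] obtain n' where
      n': "\<forall>L. int (digit p n' L) = welter_digit p (insert y (S - {x})) L mod int p" "Suc n' < n" by blast
    \<comment> \<open>For l \<le> L the beads x and y agree modulo p^l, so the pair counts do not
      change; of the digits up to L only digit L does, and it drops by one modulo p.\<close>
    have change: "[welter_digit p (insert y (S - {x})) l = welter_digit p S l - of_bool (l = L)] (mod int p)"
      if lL: "l \<le> L" for l
    proof -
      have dv: "int (p ^ l) dvd int (p ^ L)" "int (p ^ Suc l) dvd int (p ^ Suc L)"
        using lL by (simp_all only: int_dvd_int_iff le_imp_power_dvd Suc_le_mono)
      have "[int y = int x - int (p ^ L)] (mod int (p ^ Suc L))"
        by (rule cong_trans[OF xy(5) cong_diff[OF cong_sym[OF xy(4)] cong_refl]])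
      then have yx: "[int y = int x - int (p ^ L)] (mod int (p ^ Suc l))"
        using dv(2) by (rule cong_dvd_modulus)
      then have "[int y = int x - int (p ^ L)] (mod int (p ^ l))"
        by (rule cong_dvd_modulus) simp
      also have "[int x - int (p ^ L) = int x] (mod int (p ^ l))"
        using dv(1) by (simp add: cong_iff_dvd_diff)
      finally have "[int y = int x] (mod int (p ^ l))" .
      then have "residue_card T (p ^ l) (int y) = residue_card T (p ^ l) (int x)" for T
        by (rule residue_card_cong)
      moreover have "[int (digit p y l) = int (digit p x l) - of_bool (l = L)] (mod int p)"
      proof -
        obtain i where i: "L = l + i" using lL by (auto simp: le_iff_add)
        have "(int x - int (p ^ L)) div int (p ^ l) = int x div int (p ^ l) - int (p ^ i)"
          using div_mult_self1[of "int (p ^ l)" "int x" "- int (p ^ i)"] p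
          by (simp add: i power_add mult.commute)
        moreover have "[int (p ^ i) = of_bool (l = L)] (mod int p)"
          by (cases i) (simp_all add: i cong_def)
        ultimately have "[(int x - int (p ^ L)) div int (p ^ l) = int x div int (p ^ l) - of_bool (l = L)] (mod int p)"
          by (simp add: cong_diff)
        moreover have "[int x div int (p ^ l) = int (digit p x l)] (mod int p)"
          by (simp add: int_digit cong_def)
        ultimately show ?thesis
          using digit_cong[OF p yx] by (meson cong_diff cong_refl cong_trans)
      qed
      ultimately show ?thesis
        unfolding welter_digit_move[OF p S xy(1,3)] bead_digit_def
        by (simp add: cong_iff_dvd_diff algebra_simps)
    qed
    have other: "digit p n' l = digit p n l" if "l \<noteq> L" for l
      using that change[of l] xy(6) by (cases "l \<le> L") (auto intro!: same[OF n'(1)])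
    have at_L: "int (digit p n' L) = (int (digit p n L) - 1) mod int p"
      using lower[OF n'(1)] change[of L] by simp
    show False
    proof (cases "L < N")
      case True
      then have "digit p n l \<le> digit p n' l" for l
        using other[of l] N(2)[of L] by (cases "l = L") auto
      then have "n \<le> n'" by (rule digit_mono[OF p])
      then show False using n'(2) by simp
    next
      case False
      then have "L = N" "N = 0" using L by auto
      have "Suc n' = n"
      proof (rule eq_pred_from_digits[OF p, where N = N])
        show "Suc (digit p n' N) = digit p n N"
          using at_L N(1) \<open>L = N\<close> digit_less[OF p] by (intro pred_pos) auto
      qed (use other \<open>L = N\<close> \<open>N = 0\<close> in auto)
      then show False using n'(2) by simp
    qed
  qed
  have balanced: "residue_card S (p ^ L) r = residue_card {..<m} (p ^ L) r" if "L \<le> N" for L r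
    using that
  proof (induction L arbitrary: r)
    case (Suc L)
    show ?case
      by (rule balanced_step[OF p S]) (use Suc stuck in auto)
  qed (simp add: m_def)
  \<comment> \<open>The pair counts modulo p^N agree by \<open>balanced\<close> and cancel, leaving
    the digit sums, which are read off from the counts modulo p^(N+1).\<close>
  have digit_N: "welter_digit p S N - welter_digit p {..<m} N = (\<Sum>\<rho><p ^ Suc N. int (digit p \<rho> N) *
      (int (residue_card S (p ^ Suc N) (int \<rho>)) - int (residue_card {..<m} (p ^ Suc N) (int \<rho>))))"
    using balanced unfolding welter_digit_def sum_digit_eq[OF p S] sum_digit_eq[OF p finite_lessThan]
    by (simp add: right_diff_distrib sum_subtractf del: power_Suc)
  \<comment> \<open>As {..<m} has value 0, the difference is congruent to digit N of n.\<close>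
  have not_0: "\<not> [welter_digit p S N - welter_digit p {..<m} N = 0] (mod int p)"
  proof
    assume "[welter_digit p S N - welter_digit p {..<m} N = 0] (mod int p)"
    from cong_add[OF this welter_digit_lessThan[OF p, of m N]]
    have "int (digit p n N) = 0" using n[of N] by (simp add: cong_def)
    then show False using N(1) by simp
  qed
  show False
  proof (cases "N = 0")
    case True
    have "residue_card S (p ^ Suc 0) r = residue_card {..<m} (p ^ Suc 0) r" for r
      by (rule balanced_step[OF p S _ stuck]) (simp_all add: m_def)
    then show False using not_0 unfolding digit_N by (simp add: True)
  next
    case False
    let ?K = "p ^ Suc N"
    define d where "d r = int (residue_card S ?K r) - int (residue_card {..<m} ?K r)" for r
    \<comment> \<open>A blocked move by 1 bounds the growth of the counts of S from r - 1 to r by 1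
      if K divides r and by 0 otherwise. The counts of {..<m} grow by exactly this amount, because r
      is not congruent to m.\<close>
    have run: "d r \<le> d (r - 1)" if r: "\<not> int p dvd r - int m" for r
    proof -
      have nK: "\<not> int (p ^ l) dvd r - int m" if "l > 0" for l
      proof -
        have "int p dvd int (p ^ l)" using that by simp
        then show ?thesis using r by (metis dvd_trans)
      qed
      have "residue_card S ?K r \<le> residue_card S ?K (r - 1) + of_bool (int ?K dvd r)"
      proof (rule ccontr)
        assume "\<not> ?thesis"
        moreover have "0 \<le> r mod int ?K" using p by (intro pos_mod_sign) simp
        then have "r mod int ?K < 1 \<longleftrightarrow> int ?K dvd r"
          unfolding dvd_eq_mod_eq_0 by linarith
        moreover have "1 < int ?K" using p one_less_power[of p "Suc N"] by linarith
        ultimately obtain x y where xy: "x \<in> S" "y < x" "y \<notin> S" "[int x = r] (mod int ?K)"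
          "[int y = r - 1] (mod int ?K)"
          "\<forall>l\<ge>Suc N. [welter_digit p (insert y (S - {x})) l = welter_digit p S l] (mod int p)"
          using bead_move[OF p S, of 1 "Suc N" r] by (auto simp: not_le)
        from neg[OF xy(1-3)] obtain n' where
          n': "\<forall>L. int (digit p n' L) = welter_digit p (insert y (S - {x})) L mod int p" "Suc n' < n" by blast
        \<comment> \<open>Either p^l divides r, and the digit of y is one less than that of x modulo
          p; or it does not, and y has one more congruent partner than x. Both lower the digit of
          the value by one, so that the trailing zeros produce the borrow of n - 1.\<close>
        have change: "[welter_digit p (insert y (S - {x})) l = welter_digit p S l - 1] (mod int p)"
          if lN: "l \<le> N" for l
        proof -
          let ?T = "S - {x}" and ?k = "p ^ l"
          have dv: "int (p ^ l) dvd int ?K" "int (p ^ Suc l) dvd int ?K"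
            using lN by (simp_all only: int_dvd_int_iff le_imp_power_dvd Suc_le_mono le_SucI)
          have x: "[int x = r] (mod int ?k)" and y: "[int y = r - 1] (mod int ?k)"
            using cong_dvd_modulus[OF xy(4) dv(1)] cong_dvd_modulus[OF xy(5) dv(1)] by auto
          have dx: "[int (digit p x l) = r div int ?k] (mod int p)"
            and dy: "[int (digit p y l) = (r - 1) div int ?k] (mod int p)"
            using digit_cong[OF p cong_dvd_modulus[OF xy(4) dv(2)]]
              digit_cong[OF p cong_dvd_modulus[OF xy(5) dv(2)]] by auto
          have S_T: "residue_card S ?k r' = residue_card ?T ?k r' + of_bool [int x = r'] (mod int ?k)" for r'
            using residue_card_insert[of ?T x ?k r'] S xy(1) by (simp add: insert_absorb)
          have div: "(r - 1) div int ?k = r div int ?k - of_bool (int ?k dvd r)"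
            using p by (intro div_diff_one) simp
          have rc: "int (residue_card ?T ?k (int x)) = int (residue_card ?T ?k (int y)) + of_bool (int ?k dvd r) - 1"
          proof (cases "l = 0")
            case False
            have "1 < ?k" using p False by (intro one_less_power) auto
            then have "\<not> int ?k dvd 1" using int_dvd_int_iff[of ?k 1] by (metis nat_dvd_1_iff_1 less_irrefl of_nat_1)
            moreover have "int ?k dvd 1" if "[int x = r - 1] (mod int ?k)"
              using cong_trans[OF cong_sym[OF x] that] by (simp add: cong_iff_dvd_diff)
            ultimately have "\<not> [int x = r - 1] (mod int ?k)" by blast
            then have "residue_card S ?k (r - 1) = residue_card ?T ?k (int y)"
              unfolding residue_card_cong[OF y] S_T by simp
            moreover have "residue_card S ?k r = residue_card ?T ?k (int x) + 1"
              unfolding residue_card_cong[OF x] S_T using x by simp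
            moreover have "int (residue_card S ?k r) = int (residue_card S ?k (r - 1)) + of_bool (int ?k dvd r)"
              unfolding balanced[OF lN] residue_card_lessThan_diff[of m ?k r] using nK[of l] False by simp
            ultimately show ?thesis by linarith
          qed simp
          have "[int (digit p y l) - int (digit p x l) = - of_bool (int ?k dvd r)] (mod int p)"
            using cong_diff[OF dy dx] unfolding div by simp
          then show ?thesis
            unfolding welter_digit_move[OF p S xy(1,3)] bead_digit_def rc
            by (simp add: cong_iff_dvd_diff algebra_simps)
        qed
        have "Suc n' = n"
        proof (rule eq_pred_from_digits[OF p, where N = N])
          show "digit p n' L = p - 1" if "L < N" for L
            using that lower[OF n'(1) change[of L]] N(2)[of L] by (intro pred_0) simp
          show "Suc (digit p n' N) = digit p n N"
            using lower[OF n'(1) change[of N]] N(1) digit_less[OF p] by (intro pred_pos) auto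
          show "digit p n' L = digit p n L" if "N < L" for L
            using that xy(6) by (intro same[OF n'(1)]) simp
        qed (use N in auto)
        then show False using n'(2) by simp
      qed
      then show ?thesis
        using residue_card_lessThan_diff[of m ?K r] nK[of "Suc N"]
        by (cases "int ?K dvd r") (simp_all add: d_def del: power_Suc of_nat_power)
    qed
    have zero: "[(\<Sum>\<rho><?K. (int \<rho> div int (p ^ N)) * d (int \<rho>)) = 0] (mod int p)"
    proof (rule weighted_digit_sum[where d = d and m = "int m", OF p _ _ _ run])
      show "d r = d s" if "[r = s] (mod int ?K)" for r s
        unfolding d_def residue_card_cong[OF that] ..
      show "(\<Sum>t<p. d (r + int t * int (p ^ N))) = 0" for r
      proof -
        have "(\<Sum>t<p. int (residue_card T ?K (r + int t * int (p ^ N)))) = int (residue_card T (p ^ N) r)"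
          if "finite T" for T
          unfolding of_nat_sum[symmetric] power_Suc using p by (subst residue_card_split[OF that]) simp_all
        then show ?thesis
          unfolding d_def sum_subtractf using S balanced[of N r] by simp
      qed
    qed (use False in auto)
    have "[int (digit p \<rho> N) * d (int \<rho>) = (int \<rho> div int (p ^ N)) * d (int \<rho>)] (mod int p)" for \<rho>
      by (intro cong_scalar_right) (simp add: int_digit cong_def)
    then have "[(\<Sum>\<rho><?K. int (digit p \<rho> N) * d (int \<rho>)) = (\<Sum>\<rho><?K. (int \<rho> div int (p ^ N)) * d (int \<rho>))] (mod int p)"
      by (rule cong_sum)
    from cong_trans[OF this zero] show False using not_0 unfolding digit_N d_def by blast
  qed
qed

section \<open>Options in a single position\<close>

text \<open>The value as a function of the set of beads; sorting merely chooses an order, on which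
  \<open>psi\<close> does not depend.\<close>

definition welter_sg :: "nat \<Rightarrow> nat set \<Rightarrow> nat" where
  "welter_sg p S = psi p (sorted_list_of_set S)"

lemma digit_welter_sg:
  "p \<ge> 2 \<Longrightarrow> finite S \<Longrightarrow> int (digit p (welter_sg p S) L) = welter_digit p S L mod int p"
  by (simp add: welter_sg_def digit_psi)

lemma psi_eq_welter_sg:
  assumes "p \<ge> 2" "distinct A"
  shows "psi p A = welter_sg p (set A)"
proof (rule digit_eqI[OF assms(1)])
  show "digit p (psi p A) L = digit p (welter_sg p (set A)) L" for L
    using digit_psi[OF assms, of L] digit_welter_sg[OF assms(1), of "set A" L] by simp
qed

text \<open>\<open>descend\<close> is iterated. As long as the value exceeds h, the next position
  still has value at least h, and the sum of the coordinates decreases. Indexing the beads by I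
  records which coordinate each of them occupies.\<close>

lemma welter_sg_reachable_coordinatewise:
  assumes p: "p \<ge> 2" and I: "finite I"
  shows "inj_on f I \<Longrightarrow> h \<le> welter_sg p (f ` I) \<Longrightarrow>
    \<exists>g. inj_on g I \<and> (\<forall>i\<in>I. g i \<le> f i) \<and> welter_sg p (g ` I) = h"
proof (induction "\<Sum>i\<in>I. f i" arbitrary: f rule: less_induct)
  case less
  show ?case
  proof (cases "h = welter_sg p (f ` I)")
    case True
    then show ?thesis using less.prems(1) by blast
  next
    case False
    then have "welter_sg p (f ` I) > 0" using less.prems(2) by simp
    then obtain x y where xy: "x \<in> f ` I" "y < x" "y \<notin> f ` I" and
      n': "\<forall>n'. (\<forall>L. int (digit p n' L) = welter_digit p (insert y (f ` I - {x})) L mod int p)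
        \<longrightarrow> welter_sg p (f ` I) \<le> Suc n'"
      using descend[OF p, of "f ` I" "welter_sg p (f ` I)"] digit_welter_sg[OF p] I by blast
    obtain i where i: "i \<in> I" "x = f i" using xy(1) by blast
    define f' where "f' = f(i := y)"
    have f': "f' ` I = insert y (f ` I - {x})"
      using i less.prems(1) by (auto simp: f'_def inj_on_def)
    have "welter_sg p (f ` I) \<le> Suc (welter_sg p (f' ` I))"
      using n' digit_welter_sg[OF p, of "f' ` I"] I unfolding f' by blast
    then have "h \<le> welter_sg p (f' ` I)" using False less.prems(2) by simp
    moreover have "inj_on f' I"
      using less.prems(1) xy(3) by (auto simp: f'_def inj_on_def)
    moreover have "(\<Sum>j\<in>I. f' j) < (\<Sum>j\<in>I. f j)"
      using xy(2) i I by (intro sum_strict_mono_ex1) (auto simp: f'_def)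
    ultimately obtain g where g: "inj_on g I" "\<forall>i\<in>I. g i \<le> f' i" "welter_sg p (g ` I) = h"
      using less.hyps by blast
    have "f' j \<le> f j" for j using xy(2) i(2) by (simp add: f'_def)
    then have "\<forall>i\<in>I. g i \<le> f i" using g(2) order_trans by blast
    then show ?thesis using g by blast
  qed
qed

text \<open>A new bead enters exactly one runner and contributes the same there as on the whole
  board. Hence the value without its last M digits is the Nim-sum of the values of the p^M
  runners.\<close>

lemma welter_digit_components:
  assumes p: "p \<ge> 2" and "finite S"
  shows "welter_digit p S (M + L) = (\<Sum>r<p ^ M. welter_digit p (component (p ^ M) r S) L)"
  using assms(2)
proof (induction S rule: finite_induct)
  case empty
  then show ?case by (simp add: welter_digit_def residue_card_def component_def binomial_eq_0)
next
  case (insert x S)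
  let ?k = "p ^ M"
  define r q where "r = x mod ?k" and "q = x div ?k"
  have k: "?k > 0" using p by simp
  have x: "x = ?k * q + r" and r: "r < ?k" using k by (simp_all add: r_def q_def)
  have this_comp: "component ?k r (insert x S) = insert q (component ?k r S)"
    using k by (auto simp: component_def x)
  have q: "q \<notin> component ?k r S" using insert.hyps(2) by (simp add: component_def x)
  have other: "component ?k r' (insert x S) = component ?k r' S" if "r' < ?k" "r' \<noteq> r" for r'
  proof -
    have "?k * z + r' \<noteq> x" for z
      using that by (metis r_def mod_less mod_mult_self4)
    then show ?thesis by (auto simp: component_def)
  qed
  have "welter_digit p (insert x S) (M + L) = welter_digit p S (M + L) + bead_digit p S x (M + L)"
    by (rule welter_digit_insert[OF p insert.hyps])
  also have "bead_digit p S x (M + L) = bead_digit p (component ?k r S) q L"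
    unfolding x by (rule bead_digit_component[OF p r, symmetric])
  also have "welter_digit p S (M + L) + \<dots> =
      (\<Sum>r'<?k. welter_digit p (component ?k r' S) L + (if r' = r then bead_digit p (component ?k r S) q L else 0))"
    using insert.IH r by (simp add: sum.distrib)
  also have "\<dots> = (\<Sum>r'<?k. welter_digit p (component ?k r' (insert x S)) L)"
    using welter_digit_insert[OF p _ q] insert.hyps(1) k
    by (intro sum.cong) (auto simp: this_comp other)
  finally show ?case .
qed

section \<open>Change of value under coordinatewise congruence\<close>

lemma residue_card_image:
  assumes "inj_on f I"
  shows "residue_card (f ` I) k r = card {i \<in> I. [int (f i) = r] (mod int k)}"
proof -
  have "{z \<in> f ` I. [int z = r] (mod int k)} = f ` {i \<in> I. [int (f i) = r] (mod int k)}" by auto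
  moreover have "inj_on f {i \<in> I. [int (f i) = r] (mod int k)}"
    using assms by (rule inj_on_subset) auto
  ultimately show ?thesis by (simp add: residue_card_def card_image)
qed

text \<open>The common remainder modulo p^M cancels, so modulo p^(M+1) only digit M is left.\<close>

lemma diff_cong_digit:
  assumes p: "p \<ge> 2" and "[x = y] (mod p ^ M)"
  shows "[int x - int y = int (p ^ M) * (int (digit p x M) - int (digit p y M))] (mod int (p ^ (M + 1)))"
proof -
  have *: "[int z = int (z mod p ^ M) + int (p ^ M) * int (digit p z M)] (mod int (p ^ (M + 1)))" for z
  proof -
    have "[z = z mod p ^ Suc M] (mod p ^ Suc M)" by (simp add: cong_def)
    then have "[int z = int (z mod p ^ M + p ^ M * digit p z M)] (mod int (p ^ Suc M))"
      unfolding mod_power_Suc_digit cong_int_iff .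
    then show ?thesis by simp
  qed
  show ?thesis
    using cong_diff[OF *[of x] *[of y]] assms(2) by (simp add: cong_def[of x y] right_diff_distrib)
qed

lemma welter_digit_cong:
  assumes p: "p \<ge> 2" and I: "finite I" and inj: "inj_on f I" "inj_on g I"
    and cong: "\<And>i. i \<in> I \<Longrightarrow> [g i = f i] (mod p ^ M)" and L: "L \<le> M"
  shows "welter_digit p (f ` I) L - welter_digit p (g ` I) L =
    (\<Sum>i\<in>I. int (digit p (f i) L) - int (digit p (g i) L))"
proof -
  have "residue_card (f ` I) (p ^ L) r = residue_card (g ` I) (p ^ L) r" for r
  proof -
    have "[int (g i) = int (f i)] (mod int (p ^ L))" if "i \<in> I" for i
      unfolding cong_int_iff using cong[OF that] L
      by (rule cong_dvd_modulus_nat[OF _ le_imp_power_dvd])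
    then have "{i \<in> I. [int (f i) = r] (mod int (p ^ L))} = {i \<in> I. [int (g i) = r] (mod int (p ^ L))}"
      by (auto simp: cong_def simp del: of_nat_power)
    then show ?thesis by (simp only: residue_card_image[OF inj(1)] residue_card_image[OF inj(2)])
  qed
  then show ?thesis
    using inj by (simp add: welter_digit_def sum.reindex sum_subtractf)
qed

lemma welter_sg_cong:
  assumes p: "p \<ge> 2" and I: "finite I" and inj: "inj_on f I" "inj_on g I"
    and cong: "\<And>i. i \<in> I \<Longrightarrow> [g i = f i] (mod p ^ M)"
  shows "[welter_sg p (g ` I) = welter_sg p (f ` I)] (mod p ^ M)" (is ?low)
    and "[int (welter_sg p (f ` I)) - int (welter_sg p (g ` I)) = (\<Sum>i\<in>I. int (f i) - int (g i))]
      (mod int (p ^ (M + 1)))" (is ?high)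
proof -
  let ?a = "welter_sg p (f ` I)" and ?b = "welter_sg p (g ` I)"
  have dig: "[int (digit p ?a L) - int (digit p ?b L) =
      (\<Sum>i\<in>I. int (digit p (f i) L) - int (digit p (g i) L))] (mod int p)" if "L \<le> M" for L
    using digit_welter_sg[OF p, of "f ` I" L] digit_welter_sg[OF p, of "g ` I" L] I
      welter_digit_cong[OF p I inj cong that] by (simp add: cong_def mod_simps)
  have "digit p ?b L = digit p ?a L" if "L < M" for L
  proof -
    have "digit p (f i) L = digit p (g i) L" if "i \<in> I" for i
      using cong[OF that] \<open>L < M\<close> by (simp add: cong_def mod_power_eq_iff_digits[OF p])
    then have "[int (digit p ?a L) = int (digit p ?b L)] (mod int p)"
      using dig[of L] that by (simp add: cong_diff_iff_cong_0)
    then show ?thesis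
      unfolding cong_int_iff using digit_less[OF p] by (simp add: cong_def)
  qed
  then show ?low by (simp add: cong_def mod_power_eq_iff_digits[OF p])
  have "[int ?a - int ?b = int (p ^ M) * (int (digit p ?a M) - int (digit p ?b M))] (mod int (p ^ (M + 1)))"
    by (rule diff_cong_digit[OF p cong_sym[OF \<open>?low\<close>]])
  also have "[int (p ^ M) * (int (digit p ?a M) - int (digit p ?b M)) =
      int (p ^ M) * (\<Sum>i\<in>I. int (digit p (f i) M) - int (digit p (g i) M))] (mod int (p ^ (M + 1)))"
    using cong_cmult_leftI[OF dig[of M], of "int (p ^ M)"] by (simp add: mult.commute)
  also have "[int (p ^ M) * (\<Sum>i\<in>I. int (digit p (f i) M) - int (digit p (g i) M)) =
      (\<Sum>i\<in>I. int (f i) - int (g i))] (mod int (p ^ (M + 1)))"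
    unfolding sum_distrib_left
    by (intro cong_sum) (rule cong_sym[OF diff_cong_digit[OF p cong_sym[OF cong]]])
  finally show ?high .
qed

lemma welter_sg_reachable:
  assumes p: "p \<ge> 2" and I: "finite I" and inj: "inj_on f I"
    and h: "h \<le> welter_sg p (f ` I)" "[h = welter_sg p (f ` I)] (mod p ^ M)"
  shows "\<exists>g. inj_on g I \<and> (\<forall>i\<in>I. g i \<le> f i \<and> [g i = f i] (mod p ^ M)) \<and> welter_sg p (g ` I) = h"
proof -
  let ?k = "p ^ M"
  let ?n = "welter_sg p (f ` I)"
  define I' where "I' r = {i \<in> I. f i mod ?k = r}" for r
  define f' where "f' i = f i div ?k" for i
  have k: "?k > 0" using p by simp
  have comp: "component ?k r (u ` I) = v ` I' r" if r: "r < ?k" and u: "\<And>i. i \<in> I \<Longrightarrow> u i mod ?k = f i mod ?k"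
    and v: "\<And>i. i \<in> I' r \<Longrightarrow> v i = u i div ?k" for u v :: "_ \<Rightarrow> nat" and r
  proof (intro equalityI subsetI)
    fix q assume "q \<in> component ?k r (u ` I)"
    then obtain i where i: "i \<in> I" "u i = ?k * q + r" by (auto simp: component_def)
    then have "u i mod ?k = r" "u i div ?k = q" using r k by simp_all
    with i u[of i] have "i \<in> I' r" by (simp add: I'_def)
    moreover from this have "q = v i" using v \<open>u i div ?k = q\<close> by simp
    ultimately show "q \<in> v ` I' r" by blast
  next
    fix q assume "q \<in> v ` I' r"
    then obtain i where i: "i \<in> I" "f i mod ?k = r" "q = u i div ?k" using v by (auto simp: I'_def)
    then have "?k * q + r = u i" using u by (metis mult_div_mod_eq)
    then show "q \<in> component ?k r (u ` I)" using i(1) by (auto simp: component_def)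
  qed
  have inj': "inj_on f' (I' r)" for r
    using inj unfolding inj_on_def I'_def f'_def by (metis (mono_tags, lifting) mem_Collect_eq mult_div_mod_eq)
  have fin': "finite (I' r)" for r using I by (simp add: I'_def)
  \<comment> \<open>This holds for every u with the residues of f, since it is needed for f and
    again for the position g built from it.\<close>
  have nim: "digit p n (M + L) = (\<Sum>r<?k. digit p (welter_sg p (w r ` I' r)) L) mod p"
    if n: "n = welter_sg p (u ` I)" and u: "\<And>i. i \<in> I \<Longrightarrow> u i mod ?k = f i mod ?k"
      and w: "\<And>r i. i \<in> I' r \<Longrightarrow> w r i = u i div ?k" for n u and w :: "nat \<Rightarrow> _" and L
  proof -
    have "int (digit p n (M + L)) = (\<Sum>r<?k. welter_digit p (w r ` I' r) L) mod int p"
      unfolding n using comp[OF _ u w] I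
      by (simp add: digit_welter_sg[OF p] welter_digit_components[OF p])
    also have "\<dots> = (\<Sum>r<?k. int (digit p (welter_sg p (w r ` I' r)) L)) mod int p"
      using fin' by (simp add: digit_welter_sg[OF p] mod_sum_eq)
    finally show ?thesis by (simp flip: of_nat_sum zmod_int)
  qed
  have "digit p (?n div ?k) L = (\<Sum>r<?k. digit p (welter_sg p (f' ` I' r)) L) mod p" for L
    unfolding digit_div using nim[OF refl, of f "\<lambda>_. f'" L] by (simp add: f'_def)
  \<comment> \<open>\<open>n' r\<close> is the value to be reached on runner r, where no congruence
    remains to be respected.\<close>
  from nim_reachable[OF p this div_le_mono[OF h(1)]] obtain n' where
    n': "\<And>r. r < ?k \<Longrightarrow> n' r \<le> welter_sg p (f' ` I' r)"
    "\<And>L. digit p (h div ?k) L = (\<Sum>r<?k. digit p (n' r) L) mod p" by blast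
  have "\<forall>r. \<exists>G. r < ?k \<longrightarrow> inj_on G (I' r) \<and> (\<forall>i\<in>I' r. G i \<le> f' i) \<and> welter_sg p (G ` I' r) = n' r"
    using welter_sg_reachable_coordinatewise[OF p fin' inj' n'(1)] by blast
  then obtain G where G: "\<And>r. r < ?k \<Longrightarrow> inj_on (G r) (I' r)"
    "\<And>r i. r < ?k \<Longrightarrow> i \<in> I' r \<Longrightarrow> G r i \<le> f' i" "\<And>r. r < ?k \<Longrightarrow> welter_sg p (G r ` I' r) = n' r"
    by metis
  \<comment> \<open>The new quotients are put back on their old runners. The low digits of the value
    are then right by \<open>welter_sg_cong\<close>, the others by the Nim-sum over the
    runners.\<close>
  define g where "g i = ?k * G (f i mod ?k) i + f i mod ?k" for i
  have g_mod: "g i mod ?k = f i mod ?k" for i by (simp add: g_def)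
  have g_div: "G r i = g i div ?k" if "i \<in> I' r" for r i
    using that k by (auto simp: g_def I'_def)
  have inj_g: "inj_on g I"
  proof (rule inj_onI)
    fix i j assume ij: "i \<in> I" "j \<in> I" "g i = g j"
    then have "f i mod ?k = f j mod ?k" using g_mod by metis
    then have ij': "i \<in> I' (f i mod ?k)" "j \<in> I' (f i mod ?k)" using ij by (simp_all add: I'_def)
    moreover have "G (f i mod ?k) i = G (f i mod ?k) j"
      unfolding g_div[OF ij'(1)] g_div[OF ij'(2)] ij(3) ..
    ultimately show "i = j" using G(1)[of "f i mod ?k"] k by (simp add: inj_on_def)
  qed
  have le: "g i \<le> f i" if "i \<in> I" for i
  proof -
    have "G (f i mod ?k) i \<le> f i div ?k" using G(2)[of "f i mod ?k" i] k that by (simp add: I'_def f'_def)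
    then have "g i \<le> ?k * (f i div ?k) + f i mod ?k"
      unfolding g_def by (intro add_right_mono mult_le_mono2)
    then show ?thesis by simp
  qed
  have "welter_sg p (g ` I) = h"
  proof (rule digit_eqI[OF p])
    fix L
    show "digit p (welter_sg p (g ` I)) L = digit p h L"
    proof (cases "L < M")
      case True
      have "[welter_sg p (g ` I) = h] (mod ?k)"
        using welter_sg_cong(1)[OF p I inj inj_g, of M] g_mod h(2) by (simp add: cong_def)
      then show ?thesis using True by (simp add: cong_def mod_power_eq_iff_digits[OF p])
    next
      case False
      then obtain l where l: "L = M + l" by (metis le_add_diff_inverse not_less)
      have "digit p (welter_sg p (g ` I)) L = (\<Sum>r<?k. digit p (welter_sg p (G r ` I' r)) l) mod p"
        unfolding l by (rule nim[OF refl g_mod g_div])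
      also have "\<dots> = digit p h L" using n'(2)[of l] G(3) by (simp add: digit_div l)
      finally show ?thesis .
    qed
  qed
  then show ?thesis using inj_g le g_mod by (auto simp: cong_def)
qed

section \<open>Positions and sums as lists of coordinates\<close>

text \<open>Divisibility of the true difference a - b by k; the lower number comes first to fit
  \<open>list_all2\<close>.\<close>

definition desc_cong :: "nat \<Rightarrow> nat \<Rightarrow> nat \<Rightarrow> bool" where
  "desc_cong k b a \<longleftrightarrow> b \<le> a \<and> [b = a] (mod k)"

lemma image_nth: "(!) A ` {..<length A} = set A"
  by (auto simp: set_conv_nth)

lemma sum_list_diff_nth:
  "length A = length B \<Longrightarrow>
    (\<Sum>i<length A. int (A ! i) - int (B ! i)) = int (sum_list A) - int (sum_list B)"
  by (simp add: sum_list_sum_nth sum_subtractf atLeast0LessThan)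

lemma psi_cong:
  assumes p: "p \<ge> 2" and dist: "distinct A" "distinct B"
    and BA: "list_all2 (\<lambda>b a. [b = a] (mod p ^ M)) B A"
  shows "[psi p B = psi p A] (mod p ^ M)" (is ?low)
    and "[int (psi p A) - int (psi p B) = int (sum_list A) - int (sum_list B)] (mod int (p ^ (M + 1)))" (is ?high)
proof -
  have len: "length A = length B" using BA by (simp add: list_all2_lengthD)
  have inj: "inj_on ((!) A) {..<length A}" "inj_on ((!) B) {..<length A}"
    using dist len by (auto intro: inj_on_nth)
  have nth: "[B ! i = A ! i] (mod p ^ M)" if "i \<in> {..<length A}" for i
    using BA that len by (simp add: list_all2_conv_all_nth)
  have eq: "psi p A = welter_sg p ((!) A ` {..<length A})" "psi p B = welter_sg p ((!) B ` {..<length A})"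
    using psi_eq_welter_sg[OF p] dist image_nth[of A] image_nth[of B] len by simp_all
  show ?low using welter_sg_cong(1)[OF p finite_lessThan inj nth] unfolding eq .
  show ?high using welter_sg_cong(2)[OF p finite_lessThan inj nth] unfolding eq sum_list_diff_nth[OF len] .
qed

lemma psi_reachable:
  assumes p: "p \<ge> 2" and A: "distinct A" and h: "desc_cong (p ^ M) h (psi p A)"
  shows "\<exists>B. distinct B \<and> list_all2 (desc_cong (p ^ M)) B A \<and> psi p B = h"
proof -
  have "inj_on ((!) A) {..<length A}" using A by (auto intro: inj_on_nth)
  moreover have "psi p A = welter_sg p ((!) A ` {..<length A})"
    using psi_eq_welter_sg[OF p A] by (simp only: image_nth)
  ultimately obtain g where g: "inj_on g {..<length A}"
    "\<forall>i\<in>{..<length A}. g i \<le> A ! i \<and> [g i = A ! i] (mod p ^ M)" "welter_sg p (g ` {..<length A}) = h"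
    using welter_sg_reachable[OF p finite_lessThan, of "(!) A" "length A" h M] h
    by (auto simp: desc_cong_def)
  define B where "B = map g [0..<length A]"
  have "distinct B" using g(1) by (simp add: B_def distinct_map atLeast0LessThan)
  moreover have "set B = g ` {..<length A}" by (simp add: B_def atLeast0LessThan)
  moreover have "list_all2 (desc_cong (p ^ M)) B A"
    using g(2) by (simp add: B_def list_all2_conv_all_nth desc_cong_def)
  ultimately show ?thesis using g(3) psi_eq_welter_sg[OF p] by auto
qed

lemma nim_sum_digits:
  "p \<ge> 2 \<Longrightarrow> digit p (nim_sum p ns) L = (\<Sum>j<length ns. digit p (ns ! j) L) mod p"
  by (simp add: digit_nim_sum sum_list_sum_nth atLeast0LessThan)

lemma nim_sum_reachable:
  assumes p: "p \<ge> 2" and h: "desc_cong (p ^ M) h (nim_sum p ns)"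
  shows "\<exists>hs. list_all2 (desc_cong (p ^ M)) hs ns \<and> nim_sum p hs = h"
proof -
  obtain f where f: "\<forall>j<length ns. f j \<le> ns ! j \<and> [f j = ns ! j] (mod p ^ M)"
    "\<forall>L. digit p h L = (\<Sum>j<length ns. digit p (f j) L) mod p"
    using nim_reachable_cong[OF p nim_sum_digits[OF p]] h unfolding desc_cong_def by blast
  let ?hs = "map f [0..<length ns]"
  have "nim_sum p ?hs = h"
    by (rule digit_eqI[OF p]) (simp add: nim_sum_digits[OF p] f(2))
  then show ?thesis
    using f(1) by (intro exI[of _ ?hs]) (simp add: list_all2_conv_all_nth desc_cong_def)
qed

text \<open>The Nim counterpart of \<open>welter_sg_cong\<close>: digits below M agree, and digit M
  is additive modulo p.\<close>

lemma nim_sum_cong: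
  assumes p: "p \<ge> 2" and hn: "list_all2 (\<lambda>h n. [h = n] (mod p ^ M)) hs ns"
  shows "[int (nim_sum p ns) - int (nim_sum p hs) = int (sum_list ns) - int (sum_list hs)]
    (mod int (p ^ (M + 1)))"
proof -
  have len: "length ns = length hs" using hn by (simp add: list_all2_lengthD)
  have nth: "[hs ! j = ns ! j] (mod p ^ M)" if "j < length ns" for j
    using hn that len by (simp add: list_all2_conv_all_nth)
  have "digit p (nim_sum p ns) L = digit p (nim_sum p hs) L" if "L < M" for L
  proof -
    have "digit p (ns ! j) L = digit p (hs ! j) L" if "j < length ns" for j
      using nth[OF that] \<open>L < M\<close> by (simp add: cong_def mod_power_eq_iff_digits[OF p])
    then show ?thesis by (simp add: nim_sum_digits[OF p] len)
  qed
  then have low: "[nim_sum p ns = nim_sum p hs] (mod p ^ M)"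
    by (simp add: cong_def mod_power_eq_iff_digits[OF p])
  have "[int (digit p (nim_sum p ns) M) - int (digit p (nim_sum p hs) M)
      = (\<Sum>j<length ns. int (digit p (ns ! j) M)) - (\<Sum>j<length ns. int (digit p (hs ! j) M))] (mod int p)"
    by (intro cong_diff) (simp_all add: nim_sum_digits[OF p] cong_def zmod_int len)
  then have dig: "[int (digit p (nim_sum p ns) M) - int (digit p (nim_sum p hs) M)
      = (\<Sum>j<length ns. int (digit p (ns ! j) M) - int (digit p (hs ! j) M))] (mod int p)"
    by (simp add: sum_subtractf)
  have "[int (nim_sum p ns) - int (nim_sum p hs) =
      int (p ^ M) * (int (digit p (nim_sum p ns) M) - int (digit p (nim_sum p hs) M))] (mod int (p ^ (M + 1)))"
    by (rule diff_cong_digit[OF p low])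
  also have "[int (p ^ M) * (int (digit p (nim_sum p ns) M) - int (digit p (nim_sum p hs) M)) =
      int (p ^ M) * (\<Sum>j<length ns. int (digit p (ns ! j) M) - int (digit p (hs ! j) M))] (mod int (p ^ (M + 1)))"
    using cong_cmult_leftI[OF dig, of "int (p ^ M)"] by (simp add: mult.commute)
  also have "[int (p ^ M) * (\<Sum>j<length ns. int (digit p (ns ! j) M) - int (digit p (hs ! j) M)) =
      (\<Sum>j<length ns. int (ns ! j) - int (hs ! j))] (mod int (p ^ (M + 1)))"
    unfolding sum_distrib_left
    by (intro cong_sum) (rule cong_sym[OF diff_cong_digit[OF p cong_sym[OF nth]]], simp)
  finally show ?thesis unfolding sum_list_diff_nth[OF len] .
qed

lemma list_all2_concat:
  "list_all2 (list_all2 R) Bs As \<Longrightarrow> list_all2 R (concat Bs) (concat As)"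
  by (induction rule: list_all2_induct) (auto intro: list_all2_appendI)

lemma list_all2_concat_iff:
  "map length Bs = map length As \<Longrightarrow>
    list_all2 R (concat Bs) (concat As) \<longleftrightarrow> list_all2 (list_all2 R) Bs As"
proof (induction Bs arbitrary: As)
  case (Cons B Bs)
  then obtain A As' where "As = A # As'" "length B = length A" "map length Bs = map length As'" by auto
  then show ?case using Cons.IH[of As'] by (simp add: list_all2_append)
qed simp

text \<open>Both \<open>psi\<close> and the Nim-sum preserve congruence modulo p^M and change by the
  sum of the differences modulo p^(M+1), so their composition does too.\<close>

lemma psi_sum_cong:
  assumes p: "p \<ge> 2" and dist: "\<forall>A\<in>set As. distinct A" "\<forall>B\<in>set Bs. distinct B"
    and BA: "list_all2 (list_all2 (\<lambda>b a. [b = a] (mod p ^ M))) Bs As"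
  shows "[int (nim_sum p (map (psi p) As)) - int (nim_sum p (map (psi p) Bs)) =
    int (sum_list (concat As)) - int (sum_list (concat Bs))] (mod int (p ^ (M + 1)))"
proof -
  have "list_all2 (\<lambda>h n. [h = n] (mod p ^ M)) (map (psi p) Bs) (map (psi p) As)"
    using BA dist by (auto simp: list_all2_conv_all_nth intro!: psi_cong(1)[OF p])
  from nim_sum_cong[OF p this]
  have "[int (nim_sum p (map (psi p) As)) - int (nim_sum p (map (psi p) Bs)) =
    int (sum_list (map (psi p) As)) - int (sum_list (map (psi p) Bs))] (mod int (p ^ (M + 1)))" .
  also have "[int (sum_list (map (psi p) As)) - int (sum_list (map (psi p) Bs)) =
    int (sum_list (concat As)) - int (sum_list (concat Bs))] (mod int (p ^ (M + 1)))"
    using BA dist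
  proof (induction rule: list_all2_induct)
    case (Cons B Bs A As)
    then show ?case
      using cong_add[OF psi_cong(2)[OF p, of A B M] Cons.IH] by (simp add: algebra_simps)
  qed simp
  finally show ?thesis .
qed

text \<open>Nim supplies a target value for each summand, congruent to the old one modulo p^M, and
  each target is reached inside its own summand.\<close>

lemma psi_sum_reachable:
  assumes p: "p \<ge> 2" and dist: "\<forall>A\<in>set As. distinct A"
    and h: "desc_cong (p ^ M) h (nim_sum p (map (psi p) As))"
  shows "\<exists>Bs. (\<forall>B\<in>set Bs. distinct B) \<and> list_all2 (list_all2 (desc_cong (p ^ M))) Bs As
    \<and> nim_sum p (map (psi p) Bs) = h"
proof -
  obtain hs where hs: "list_all2 (desc_cong (p ^ M)) hs (map (psi p) As)" "nim_sum p hs = h"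
    using nim_sum_reachable[OF p h] by blast
  from hs(1) dist have "\<exists>Bs. (\<forall>B\<in>set Bs. distinct B) \<and>
      list_all2 (list_all2 (desc_cong (p ^ M))) Bs As \<and> map (psi p) Bs = hs"
  proof (induction hs "map (psi p) As" arbitrary: As rule: list_all2_induct)
    case Nil
    then show ?case by simp
  next
    case (Cons x xs y ys)
    then obtain A As' where As: "As = A # As'" "y = psi p A" "ys = map (psi p) As'" by auto
    obtain Bs where "\<forall>B\<in>set Bs. distinct B" "list_all2 (list_all2 (desc_cong (p ^ M))) Bs As'"
      "map (psi p) Bs = xs" using Cons As by auto
    moreover obtain B where "distinct B" "list_all2 (desc_cong (p ^ M)) B A" "psi p B = x"
      using psi_reachable[OF p, of A M x] Cons As by auto
    ultimately show ?case unfolding As by (intro exI[of _ "B # Bs"]) simp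
  qed
  then show ?thesis using hs(2) by metis
qed

section \<open>Recognising Sprague-Grundy functions and saturated moves\<close>

lemma sg_eqI:
  assumes game: "impartial_game V E"
    and diff: "\<And>A B. (A, B) \<in> E \<Longrightarrow> f A \<noteq> f B"
    and options: "\<And>A h. A \<in> V \<Longrightarrow> h < f A \<Longrightarrow> \<exists>B. (A, B) \<in> E \<and> f B = h"
  shows "A \<in> V \<Longrightarrow> sg E A = f A"
proof (induction A rule: wf_induct_rule[OF impartial_game_wf[OF game]])
  case (1 A)
  have "E \<subseteq> V \<times> V" using game by (simp add: impartial_game_def)
  then have "{sg E B |B. (A, B) \<in> E} = {f B |B. (A, B) \<in> E}" using 1 by force
  then have "sg E A = (LEAST n. n \<notin> {f B |B. (A, B) \<in> E})"
    by (subst sg_rec[OF game]) (simp only: mex_def)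
  also have "\<dots> = f A"
  proof (rule Least_equality)
    show "f A \<notin> {f B |B. (A, B) \<in> E}" using diff by blast
    show "f A \<le> n" if "n \<notin> {f B |B. (A, B) \<in> E}" for n
      using that options[OF 1(2), of n] by (force simp: not_le[symmetric])
  qed
  finally show ?case .
qed

text \<open>The order enters only through divisibility by powers, which makes sense for composite p
  as well.\<close>

lemma ord_p_ge_iff:
  "p \<ge> 2 \<Longrightarrow> enat M \<le> ord_p p (int c) \<longleftrightarrow> p ^ M dvd c"
  using power_dvd_iff_le_multiplicity[of "int c" "int p" M]
  by (auto simp: ord_p_def simp flip: int_dvd_int_iff)

lemma mord_p_ge_iff:
  "p \<ge> 2 \<Longrightarrow> C \<noteq> [] \<Longrightarrow> enat M \<le> mord_p p C \<longleftrightarrow> (\<forall>c\<in>set C. p ^ M dvd c)"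
  by (simp add: mord_p_def ord_p_ge_iff)

lemma mord_p_finite:
  assumes "p \<ge> 2" "C \<in> vecs m" "C \<noteq> zero_vec m"
  obtains M where "mord_p p C = enat M"
proof -
  have ne: "C \<noteq> []" using assms by (auto simp: vecs_def zero_vec_def)
  obtain c where c: "c \<in> set C" "c \<noteq> 0"
    using assms(2,3) by (auto simp: vecs_def zero_vec_def list_eq_iff_nth_eq in_set_conv_nth)
  have "mord_p p C \<le> ord_p p (int c)" using c(1) by (simp add: mord_p_def)
  then show ?thesis using c(2) that by (cases "mord_p p C") (auto simp: ord_p_def)
qed

text \<open>An M dividing out of all entries but failing at M + 1 for the sum must be both orders,
  since any power dividing all entries divides the sum. This form avoids the minimum and the
  infinite order, and it excludes the zero vector by itself.\<close>

lemma sat_vecs_iff: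
  assumes p: "p \<ge> 2"
  shows "C \<in> sat_vecs p m \<longleftrightarrow>
    length C = m \<and> (\<exists>M. (\<forall>c\<in>set C. p ^ M dvd c) \<and> \<not> p ^ (M + 1) dvd sum_list C)"
proof
  assume C: "C \<in> sat_vecs p m"
  then have ne: "C \<noteq> []" by (auto simp: sat_vecs_def vecs_def zero_vec_def)
  obtain M where M: "mord_p p C = enat M" using C mord_p_finite[OF p] by (auto simp: sat_vecs_def)
  then have "\<forall>c\<in>set C. p ^ M dvd c" using mord_p_ge_iff[OF p ne, of M] by simp
  moreover have "\<not> enat (M + 1) \<le> ord_p p (int (sum_list C))" using C M by (simp add: sat_vecs_def)
  ultimately show "length C = m \<and> (\<exists>M. (\<forall>c\<in>set C. p ^ M dvd c) \<and> \<not> p ^ (M + 1) dvd sum_list C)"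
    using C unfolding ord_p_ge_iff[OF p] by (auto simp: sat_vecs_def vecs_def)
next
  assume "length C = m \<and> (\<exists>M. (\<forall>c\<in>set C. p ^ M dvd c) \<and> \<not> p ^ (M + 1) dvd sum_list C)"
  then obtain M where len: "length C = m" and M: "\<forall>c\<in>set C. p ^ M dvd c" "\<not> p ^ (M + 1) dvd sum_list C"
    by blast
  have dvd_sum: "d dvd sum_list C" if "\<forall>c\<in>set C. d dvd c" for d
    using that by (induction C) auto
  have ne: "C \<noteq> []" using M(2) by auto
  have "C \<noteq> zero_vec m" using M(2) by (auto simp: zero_vec_def sum_list_replicate)
  have exact: "x = enat M" if "enat M \<le> x" "\<not> enat (M + 1) \<le> x" for x
    using that by (cases x) auto
  have "\<not> (\<forall>c\<in>set C. p ^ (M + 1) dvd c)" using M(2) dvd_sum by blast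
  then have "mord_p p C = enat M"
    by (intro exact) (use mord_p_ge_iff[OF p ne] M(1) in blast)+
  moreover have "ord_p p (int (sum_list C)) = enat M"
    by (intro exact) (use ord_p_ge_iff[OF p] M dvd_sum in blast)+
  ultimately have "mord_p p C = ord_p p (int (sum_list C))" by simp
  then show "C \<in> sat_vecs p m"
    using len \<open>C \<noteq> zero_vec m\<close> by (simp add: sat_vecs_def vecs_def)
qed

section \<open>Sums of Welter games\<close>

lemma mem_vdiff_dvd_iff:
  assumes "list_all2 (\<le>) B A"
  shows "(\<forall>c\<in>set (vdiff A B). k dvd c) \<longleftrightarrow> list_all2 (desc_cong k) B A"
  using assms
proof (induction rule: list_all2_induct)
  case (Cons b B a A)
  then show ?case by (auto simp: vdiff_def desc_cong_def cong_def mod_eq_dvd_iff_nat[of b a k] eq_commute[of "b mod k"])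
qed (simp add: vdiff_def)

lemma sum_list_vdiff:
  "list_all2 (\<le>) B A \<Longrightarrow> int (sum_list (vdiff A B)) = int (sum_list A) - int (sum_list B)"
proof (induction rule: list_all2_induct)
  case (Cons b B a A)
  then show ?case by (simp add: vdiff_def)
qed (simp add: vdiff_def)

lemma exact_power_dvd:
  fixes c p :: nat
  assumes "p \<ge> 2" "c > 0"
  obtains M where "p ^ M dvd c" "\<not> p ^ (M + 1) dvd c"
  using that[of "multiplicity p c"] power_dvd_iff_le_multiplicity[of c p "multiplicity p c + 1"] assms
  by (auto simp: multiplicity_dvd)

lemma mem_positions_Welter: "A \<in> positions (Welter m) \<longleftrightarrow> length A = m \<and> distinct A"
  by (auto simp: Welter_def vecs_def distinct_conv_nth) (metis linorder_neqE_nat)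

lemma dim_Welter [simp]: "dim (Welter m) = m"
  by (simp add: Welter_def)

lemma dim_Welter_sum [simp]: "dim (disjunctive_sum (map Welter ms)) = sum_list ms"
  by (simp add: disjunctive_sum_def o_def)

lemma positions_Welter_sum:
  "positions (disjunctive_sum (map Welter ms)) =
    {concat As |As. map length As = ms \<and> (\<forall>A\<in>set As. distinct A)}"
proof -
  have "list_all2 (\<lambda>A G. A \<in> positions G) As (map Welter ms) \<longleftrightarrow>
      map length As = ms \<and> (\<forall>A\<in>set As. distinct A)" for As
    unfolding list_all2_map2 mem_positions_Welter
    by (auto simp: list_all2_conv_all_nth list_eq_iff_nth_eq all_set_conv_all_nth)
  then show ?thesis by (simp add: disjunctive_sum_def)
qed

lemma concat_zero_update:
  "i < length ms \<Longrightarrow> length C = ms ! i \<Longrightarrow>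
    length (concat ((map zero_vec ms)[i := C])) = sum_list ms \<and>
    sum_list (concat ((map zero_vec ms)[i := C])) = sum_list C \<and>
    set (concat ((map zero_vec ms)[i := C])) \<subseteq> insert 0 (set C)"
proof (induction ms arbitrary: i)
  case (Cons m ms)
  have zero: "length (concat (map zero_vec ms)) = sum_list ms"
    "sum_list (concat (map zero_vec ms)) = 0" "set (concat (map zero_vec ms)) \<subseteq> {0}"
    by (induction ms) (auto simp: zero_vec_def sum_list_replicate)
  show ?case
  proof (cases i)
    case 0
    then show ?thesis using Cons.prems zero by auto
  next
    case (Suc j)
    have "set (zero_vec m) \<subseteq> {0}" "sum_list (zero_vec m) = 0" "length (zero_vec m) = m"
      by (auto simp: zero_vec_def sum_list_replicate)
    then show ?thesis using Cons.prems Cons.IH[of j] Suc by auto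
  qed
qed simp

text \<open>With a single nonzero entry the sum is that entry, so the two orders coincide. Adjoining
  \<open>sat_vecs\<close> therefore leaves a game whose subtrahends are exactly
  \<open>sat_vecs\<close>.\<close>

lemma subtrahends_Welter_sum:
  assumes p: "p \<ge> 2"
  shows "subtrahends (disjunctive_sum (map Welter ms)) \<subseteq> sat_vecs p (sum_list ms)"
proof
  fix D assume "D \<in> subtrahends (disjunctive_sum (map Welter ms))"
  then obtain i C where i: "i < length ms" "C \<in> subtrahends (Welter (ms ! i))"
    and D: "D = concat ((map zero_vec ms)[i := C])"
    by (auto simp: disjunctive_sum_def o_def)
  then obtain j where j: "length C = ms ! i" "j < length C" "C ! j \<noteq> 0"
    "\<And>j'. j' < length C \<Longrightarrow> C ! j' \<noteq> 0 \<Longrightarrow> j' = j"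
    by (auto simp: Welter_def vecs_def)
  have sum: "sum_list C = C ! j"
  proof -
    have "sum_list C = (\<Sum>l<length C. C ! l)" by (simp add: sum_list_sum_nth atLeast0LessThan)
    also have "\<dots> = (\<Sum>l\<in>{j}. C ! l)"
    proof (rule sum.mono_neutral_right)
      show "\<forall>l\<in>{..<length C} - {j}. C ! l = 0" using j(4) by blast
    qed (use j(2) in auto)
    finally show ?thesis by simp
  qed
  have set_C: "set C \<subseteq> {0, C ! j}" using j(4) unfolding set_conv_nth by blast
  obtain M where M: "p ^ M dvd C ! j" "\<not> p ^ (M + 1) dvd C ! j"
    using exact_power_dvd[OF p] j(3) by blast
  have "\<forall>c\<in>set D. p ^ M dvd c" "sum_list D = C ! j" "length D = sum_list ms"
    using concat_zero_update[OF i(1) j(1)] set_C M(1) sum unfolding D by auto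
  then show "D \<in> sat_vecs p (sum_list ms)" unfolding sat_vecs_iff[OF p] using M(2) by auto
qed

text \<open>C is left open to cover the saturated game as well as Welter's game itself.\<close>

lemma is_subtraction_game_Welter_sum:
  assumes p: "p \<ge> 2" and "C \<subseteq> sat_vecs p (sum_list ms)"
  shows "is_subtraction_game ((disjunctive_sum (map Welter ms))\<lparr>subtrahends := C\<rparr>)"
  using assms(2) by (auto simp: is_subtraction_game_def positions_Welter_sum vecs_def sat_vecs_def length_concat)

lemma concat_eq_imp_eq:
  "map length As = map length Bs \<Longrightarrow> concat As = concat Bs \<Longrightarrow> As = Bs"
proof (induction As arbitrary: Bs)
  case (Cons A As)
  then show ?case by (cases Bs) auto
qed simp

lemma sg_saturated_Welter_sum:
  assumes p: "p \<ge> 2" and sat: "p_saturation p (disjunctive_sum (map Welter ms)) G"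
    and As: "map length As = ms" "concat As \<in> positions G"
  shows "sg (moves G) (concat As) = nim_sum p (map (psi p) As)"
proof -
  define G0 where "G0 = disjunctive_sum (map Welter ms)"
  define G1 where "G1 = G0\<lparr>subtrahends := sat_vecs p (sum_list ms)\<rparr>"
  \<comment> \<open>The candidate value must be a function of the flat vector, so the blocks are
    recovered from it; their lengths make this unique by \<open>concat_eq_imp_eq\<close>.\<close>
  define f where "f X = nim_sum p (map (psi p) (THE As. map length As = ms \<and> concat As = X))" for X
  have f: "f (concat As) = nim_sum p (map (psi p) As)" if "map length As = ms" for As
  proof -
    have "(THE As'. map length As' = ms \<and> concat As' = concat As) = As"
      using that concat_eq_imp_eq by (intro the_equality) auto
    then show ?thesis by (simp add: f_def)
  qed
  have pos: "positions G1 = {concat As |As. map length As = ms \<and> (\<forall>A\<in>set As. distinct A)}"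
    by (simp add: G1_def G0_def positions_Welter_sum)
  have moves: "(X, Y) \<in> moves G1 \<longleftrightarrow> X \<in> positions G1 \<and> Y \<in> positions G1 \<and>
      list_all2 (\<le>) Y X \<and> vdiff X Y \<in> sat_vecs p (sum_list ms)" for X Y
    by (simp add: moves_def G1_def)
  have value_diff: "[int (f (concat As)) - int (f (concat Bs)) = int (sum_list (vdiff (concat As) (concat Bs)))]
      (mod int (p ^ (M + 1)))"
    if "map length As = ms" "map length Bs = ms" "\<forall>A\<in>set As. distinct A" "\<forall>B\<in>set Bs. distinct B"
      and le: "list_all2 (desc_cong (p ^ M)) (concat Bs) (concat As)" for As Bs M
  proof -
    have "list_all2 (list_all2 (\<lambda>b a. [b = a] (mod p ^ M))) Bs As"
      using le that(1,2) by (subst list_all2_concat_iff[symmetric])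
        (auto elim: list_all2_mono simp: desc_cong_def)
    moreover have "list_all2 (\<le>) (concat Bs) (concat As)"
      using le by (rule list_all2_mono) (simp add: desc_cong_def)
    ultimately show ?thesis
      using psi_sum_cong[OF p that(3,4)] that(1,2) by (simp add: f sum_list_vdiff)
  qed
  have "sg (moves G1) X = f X" if "X \<in> positions G1" for X
    using _ _ _ that
  proof (rule sg_eqI)
    show "impartial_game (positions G1) (moves G1)"
      unfolding G1_def G0_def
      by (rule impartial_game_moves[OF is_subtraction_game_Welter_sum[OF p order_refl]])
  next
    fix X Y assume "(X, Y) \<in> moves G1"
    then obtain As Bs where As: "X = concat As" "map length As = ms" "\<forall>A\<in>set As. distinct A"
      and Bs: "Y = concat Bs" "map length Bs = ms" "\<forall>B\<in>set Bs. distinct B"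
      and le: "list_all2 (\<le>) Y X" and "vdiff X Y \<in> sat_vecs p (sum_list ms)"
      unfolding moves pos by blast
    then obtain M where M: "\<forall>c\<in>set (vdiff X Y). p ^ M dvd c" "\<not> p ^ (M + 1) dvd sum_list (vdiff X Y)"
      unfolding sat_vecs_iff[OF p] by blast
    have "[int (f X) - int (f Y) = int (sum_list (vdiff X Y))] (mod int (p ^ (M + 1)))"
      unfolding As(1) Bs(1) using As Bs M(1) le by (intro value_diff) (simp_all add: mem_vdiff_dvd_iff)
    moreover have "\<not> int (p ^ (M + 1)) dvd int (sum_list (vdiff X Y))"
      using M(2) by (simp only: int_dvd_int_iff not_False_eq_True)
    ultimately show "f X \<noteq> f Y"
      by (metis cong_dvd_iff diff_self dvd_0_right)
  next
    fix X h assume "X \<in> positions G1" and h: "h < f X"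
    then obtain As where As: "X = concat As" "map length As = ms" "\<forall>A\<in>set As. distinct A"
      unfolding pos by blast
    \<comment> \<open>M is the exact order of f X - h. An option agreeing with X modulo p^M and of
      value h has coordinate differences with sum congruent to f X - h modulo p^(M+1); this sum is
      thus not divisible by p^(M+1), as a saturated move requires.\<close>
    obtain M where M: "p ^ M dvd f X - h" "\<not> p ^ (M + 1) dvd f X - h"
      using exact_power_dvd[OF p, of "f X - h"] h by auto
    have "desc_cong (p ^ M) h (nim_sum p (map (psi p) As))"
      using M(1) h mod_eq_dvd_iff_nat[of h "f X" "p ^ M"] As
      by (simp add: f desc_cong_def cong_def)
    from psi_sum_reachable[OF p As(3) this] obtain Bs where
      Bs: "\<forall>B\<in>set Bs. distinct B" "list_all2 (list_all2 (desc_cong (p ^ M))) Bs As"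
        "nim_sum p (map (psi p) Bs) = h" by blast
    let ?Y = "concat Bs"
    have len: "map length Bs = ms"
      using Bs(2) As(2) by (auto simp: list_all2_conv_all_nth intro!: nth_equalityI)
    have desc: "list_all2 (desc_cong (p ^ M)) ?Y X"
      unfolding As(1) using Bs(2) by (rule list_all2_concat)
    then have le: "list_all2 (\<le>) ?Y X" by (rule list_all2_mono) (simp add: desc_cong_def)
    have fY: "f ?Y = h" using f[OF len] Bs(3) by simp
    have "[int (f X) - int h = int (sum_list (vdiff X ?Y))] (mod int (p ^ (M + 1)))"
      using value_diff[OF As(2) len As(3) Bs(1)] desc fY by (simp add: As(1))
    moreover have "\<not> int (p ^ (M + 1)) dvd int (f X) - int h"
      using M(2) h by (simp only: int_dvd_int_iff of_nat_diff[symmetric] less_imp_le_nat not_False_eq_True)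
    ultimately have "\<not> int (p ^ (M + 1)) dvd int (sum_list (vdiff X ?Y))" by (simp add: cong_dvd_iff)
    then have "\<not> p ^ (M + 1) dvd sum_list (vdiff X ?Y)" by (simp only: int_dvd_int_iff not_False_eq_True)
    moreover have "\<forall>c\<in>set (vdiff X ?Y). p ^ M dvd c" using mem_vdiff_dvd_iff[OF le] desc by blast
    moreover have "length (vdiff X ?Y) = sum_list ms"
      using list_all2_lengthD[OF le] As by (simp add: vdiff_def length_concat)
    ultimately have "vdiff X ?Y \<in> sat_vecs p (sum_list ms)" unfolding sat_vecs_iff[OF p] by blast
    moreover have "?Y \<in> positions G1" unfolding pos using Bs(1) len by blast
    ultimately have "(X, ?Y) \<in> moves G1"
      unfolding moves using \<open>X \<in> positions G1\<close> le by simp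
    with fY show "\<exists>Y. (X, Y) \<in> moves G1 \<and> f Y = h" by (intro exI[of _ ?Y] conjI)
  qed
  moreover have "subtrahends G0 \<union> sat_vecs p (dim G0) = sat_vecs p (sum_list ms)"
    using subtrahends_Welter_sum[OF p, of ms] by (auto simp: G0_def)
  then have "sg (moves G) X = sg (moves G1) X" if "X \<in> positions G" for X
    using sat that by (auto simp: p_saturation_def G1_def simp flip: G0_def)
  moreover have "positions G = positions G1"
    using sat by (simp add: p_saturation_def G1_def G0_def)
  ultimately show ?thesis using As f by simp
qed

section \<open>Calmness of a single Welter game\<close>

lemma disjunctive_sum_single: "disjunctive_sum [Welter m] = Welter m"
proof -
  have "{concat As |As. list_all2 (\<lambda>A G. A \<in> positions G) As [Welter m]} = positions (Welter m)"
    by (force simp: list_all2_Cons2)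
  moreover have "{concat ((map (\<lambda>G. zero_vec (dim G)) [Welter m])[i := C]) |i C.
      i < length [Welter m] \<and> C \<in> subtrahends ([Welter m] ! i)} = subtrahends (Welter m)"
    by auto
  ultimately show ?thesis by (simp add: disjunctive_sum_def)
qed

lemma nim_sum_single:
  assumes p: "p \<ge> 2"
  shows "nim_sum p [n] = n"
  by (rule digit_eqI[OF p]) (simp add: digit_nim_sum[OF p] digit_less[OF p])

text \<open>For M the minimal order of A - B the coordinates agree modulo p^M, and
  \<open>psi_cong\<close> gives the congruence modulo p^(M+1). The descendant relation supplies that
  B is a position, coordinatewise below A and different from it.\<close>

lemma p_calm_Welter:
  assumes p: "p \<ge> 2"
  shows "p_calm p (Welter m)"
  unfolding p_calm_def
proof (intro conjI allI impI)
  have sat: "subtrahends (Welter m) \<subseteq> sat_vecs p m"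
    using subtrahends_Welter_sum[OF p, of "[m]"] by (simp add: disjunctive_sum_single)
  then show "subtrahends (Welter m) \<subseteq> sat_vecs p (dim (Welter m))" by simp
  show game: "is_subtraction_game (Welter m)"
    using is_subtraction_game_Welter_sum[OF p, of "subtrahends (Welter m)" "[m]"] sat
    by (simp add: disjunctive_sum_single)
  fix G A B
  assume asm: "p_saturation p (Welter m) G \<and> A \<in> positions (Welter m) \<and> proper_descendant (moves (Welter m)) A B"
  then have AB: "(A, B) \<in> (moves (Welter m))\<^sup>*" "A \<noteq> B" by (auto simp: proper_descendant_def)
  have le: "list_all2 (\<le>) B A" by (rule descendant_le[OF AB(1)])
  have A: "A \<in> positions (Welter m)" using asm by blast
  have B: "B \<in> positions (Welter m)" using AB(1) A by (cases rule: rtranclE) (auto simp: moves_def)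
  have len: "length A = m" "length B = m" and dist: "distinct A" "distinct B"
    using A B by (auto simp: mem_positions_Welter)
  have sg: "sg (moves G) C = psi p C" if "C \<in> positions (Welter m)" for C
    using sg_saturated_Welter_sum[OF p, of "[m]" G "[C]"] that asm
    by (auto simp: disjunctive_sum_single mem_positions_Welter nim_sum_single[OF p] p_saturation_def)
  have vecs: "vdiff A B \<in> vecs m" "vdiff A B \<noteq> zero_vec m"
    using vdiff_eq_zero[OF le] AB(2) len by (auto simp: vecs_def vdiff_def zero_vec_def)
  then have ne: "vdiff A B \<noteq> []" by (auto simp: vecs_def zero_vec_def)
  obtain M where M: "mord_p p (vdiff A B) = enat M" using mord_p_finite[OF p vecs] .
  then have "\<forall>c\<in>set (vdiff A B). p ^ M dvd c" using mord_p_ge_iff[OF p ne, of M] by simp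
  then have "list_all2 (\<lambda>b a. [b = a] (mod p ^ M)) B A"
    unfolding mem_vdiff_dvd_iff[OF le] by (rule list_all2_mono) (simp add: desc_cong_def)
  from psi_cong(2)[OF p dist this]
  show "[int (sg (moves G) A) - int (sg (moves G) B) = (\<Sum>i<dim (Welter m). int (A ! i) - int (B ! i))]
      (mod int p ^ (the_enat (mord_p p (vdiff A B)) + 1))"
    using sum_list_diff_nth[of A B] len by (simp add: sg A B M)
qed

theorem theorem3p13:
  fixes p :: nat
  assumes "p \<ge> 2"
  shows "(\<forall>m\<ge>1. p_calm p (Welter m)) \<and>
    (\<forall>(ms :: nat list) G (As :: nat list list).
       ms \<noteq> [] \<and> (\<forall>m\<in>set ms. m \<ge> 1) \<and>
       p_saturation p (disjunctive_sum (map Welter ms)) G \<and>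
       map length As = ms \<and> concat As \<in> positions G \<longrightarrow>
       sg (moves G) (concat As) = nim_sum p (map (psi p) As))"
  using p_calm_Welter[OF assms] sg_saturated_Welter_sum[OF assms] by blast

end
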